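(* (Tractable reformulation) Suppose that the feasible region $\mathscr{X}$ and the uncertainty support $\varXi$ are convex and closed, the loss function $f(\boldsymbol{x})$ is convex, and the loss function is $g(\boldsymbol{x},\boldsymbol{w})=\max_{i\in[I]}h_i(\boldsymbol{x},\boldsymbol{w})$, where for each $i\in[I]$ the function $h_i(\boldsymbol{x},\boldsymbol{w})$ is proper, upper semicontinuous, convex in $\boldsymbol{x}$, and concave in $\boldsymbol{w}$. Then the problem $$\min_{\boldsymbol{x}\in\mathscr{X}}\Big\{f(\boldsymbol{x})+\sup_{\mathbb{Q}\in\mathscr{B}(\Gamma^N)}\mathbb{E}_{\mathbb{Q}}[g(\boldsymbol{x},\boldsymbol{w})]\Big\}$$ admits the following equivalent finite convex reformulation: $$\begin{aligned}\min_{\boldsymbol{x},\lambda_k,\alpha_{\widehat{\boldsymbol{w}}},\boldsymbol{z}_{\widehat{\boldsymbol{w}},i},\boldsymbol{v}_{\widehat{\boldsymbol{w}},i}}\ &f(\boldsymbol{x})+\sum_{k=1}^K\frac{|\Gamma^N_k|}{|\Gamma^N|}\Big[\lambda_k\theta_k+\sum_{\widehat{\boldsymbol{w}}\in\Gamma^N_k}\frac{\alpha_{\widehat{\boldsymbol{w}}}}{|\Gamma^N_k|}\Big]\\ \text{s.t.}\ &\alpha_{\widehat{\boldsymbol{w}}}\ge[-h_i]^\ast(\boldsymbol{x},\boldsymbol{z}_{\widehat{\boldsymbol{w}},i}-\boldsymbol{v}_{\widehat{\boldsymbol{w}},i})+\sigma_{\varXi}(\boldsymbol{v}_{\widehat{\boldsymbol{w}},i})-\langle\boldsymbol{z}_{\widehat{\boldsymbol{w}},i},\widehat{\boldsymbol{w}}\rangle,\quad\forall\widehat{\boldsymbol{w}}\in\Gamma^N,\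 \forall i\in[I],\\ &\|\boldsymbol{z}_{\widehat{\boldsymbol{w}},i}\|_\ast\le\lambda_k,\quad\forall k\in[K],\ \forall\widehat{\boldsymbol{w}}\in\Gamma^N_k,\ \forall i\in[I],\\ &\boldsymbol{x}\in\mathscr{X},\ \lambda_k\ge0,\ \alpha_{\widehat{\boldsymbol{w}}}\in\mathbb{R},\ \boldsymbol{z}_{\widehat{\boldsymbol{w}},i}\in\mathbb{R}^m,\ \boldsymbol{v}_{\widehat{\boldsymbol{w}},i}\in\mathbb{R}^m,\quad\forall k\in[K],\ \forall\widehat{\boldsymbol{w}}\in\Gamma^N,\ \forall i\in[I],\end{aligned}$$ where $[-h_i]^\ast(\boldsymbol{x},\boldsymbol{z})=\sup_{\boldsymbol{w}\in\varXi}\{\langle\boldsymbol{z},\boldsymbol{w}\rangle+h_i(\boldsymbol{x},\boldsymbol{w})\}$ is the conjugate function of $-h_i$, $\|\cdot\|_\ast$ is the dual norm of $\|\cdot\|$, and $\sigma_{\varXi}(\boldsymbol{z})=\sup_{\boldsymbol{w}\in\varXi}\langle\boldsymbol{z},\boldsymbol{w}\rangle$ is the support function of $\varXi$. Here equivalent means that, for each fixed $\boldsymbol{x}\in\mathscr{X}$, the optimal value of the second problem over the remaining variables equals the objective of the first problem at $\boldsymbol{x}$ (so the two problems have the same optimal value); finite convex means that the second problem is a finite-dimensional convex program with finitely many constraints.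
   Context: $[N]=\{1,\dots,N\}$; $\mathscr{X}\subseteq\mathbb{R}^n$ is the feasible region; $\varXi\subseteq\mathbb{R}^m$ is the support set of the uncertainty $\boldsymbol{w}$; $f:\mathbb{R}^n\to\overline{\mathbb{R}}$ and $g:\mathbb{R}^n\times\mathbb{R}^m\to\overline{\mathbb{R}}$ are loss functions, $\overline{\mathbb{R}}=\mathbb{R}\cup\{\pm\infty\}$; $\|\cdot\|$ is a norm on $\mathbb{R}^m$. Minima are optimal values (infima, equal to $+\infty$ for infeasible problems). $\mathscr{P}(\varXi)$ is the set of Borel probability measures supported on $\varXi$; $d_W(\mathbb{Q},\mathbb{P})=\inf_{\pi\in\Pi(\mathbb{Q},\mathbb{P})}\int\|\boldsymbol{x}-\boldsymbol{y}\|\,d\pi(\boldsymbol{x},\boldsymbol{y})$, with $\Pi(\mathbb{Q},\mathbb{P})$ the measures on $\varXi\times\varXi$ with marginals $\mathbb{Q},\mathbb{P}$; $\mathscr{W}_\theta(\mathbb{P})=\{\mathbb{Q}\in\mathscr{P}(\varXi):d_W(\mathbb{Q},\mathbb{P})\le\theta\}$. $\Gamma^N$ is a collection of $N$ data points $\widehat{\boldsymbol{w}}_l\in\varXi$, $l\in[N]$ (counted with multiplicity, $|\Gamma^N|=N$), partitioned by a clustering rule into $K$ nonempty clusters $\Gamma^N_k$, $k\in[K]$ (in the paper, maximum-posterior labels of a Dirichlet process mixture model; any partition is allowed here). $\widehat{\mathbb{P}}^N_k=\frac1{|\Gamma^N_k|}\sum_{\widehat{\boldsymbol{w}}\in\Gamma^N_k}\delta_{\widehat{\boldsymbol{w}}}$,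 and $\theta_k>0$ is the Wasserstein radius of cluster $k$. The data-driven ambiguity set is $$\mathscr{B}(\Gamma^N)=\Big\{\sum_{k=1}^K\frac{|\Gamma^N_k|}{|\Gamma^N|}\mathbb{Q}_k:\ \mathbb{Q}_k\in\mathscr{W}_{\theta_k}(\widehat{\mathbb{P}}^N_k),\ k\in[K]\Big\}.$$ *)

theory Defs
  imports "HOL-Probability.Probability"
begin

text \<open>Convexity of an extended-real-valued function is convexity of its epigraph, so that both
  infinite values are allowed.\<close>

definition ereal_convex :: "('a::real_vector \<Rightarrow> ereal) \<Rightarrow> bool" where
  "ereal_convex u \<longleftrightarrow> convex {(x, r::real). u x \<le> ereal r}"

definition ereal_concave :: "('a::real_vector \<Rightarrow> ereal) \<Rightarrow> bool" where
  "ereal_concave u \<longleftrightarrow> ereal_convex (\<lambda>x. - u x)"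

definition upper_semicontinuous :: "('a::topological_space \<Rightarrow> ereal) \<Rightarrow> bool" where
  "upper_semicontinuous u \<longleftrightarrow> (\<forall>x. \<forall>a > u x. eventually (\<lambda>y. u y < a) (nhds x))"

definition conjugate_on :: "'a::real_inner set \<Rightarrow> ('a \<Rightarrow> ereal) \<Rightarrow> 'a \<Rightarrow> ereal" where
  "conjugate_on \<Xi> u z = (SUP w\<in>\<Xi>. ereal (z \<bullet> w) - u w)"

definition support_fun :: "'a::real_inner set \<Rightarrow> 'a \<Rightarrow> ereal" where
  "support_fun \<Xi> z = (SUP w\<in>\<Xi>. ereal (z \<bullet> w))"

text \<open>The norm on the uncertainty space is an arbitrary one, not the Euclidean norm of the type.
  Nonnegativity follows from the three axioms. The supremum in the dual norm is that of a nonempty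
  bounded set of reals, because all norms on a finite-dimensional space are equivalent.\<close>

definition is_norm :: "('a::real_vector \<Rightarrow> real) \<Rightarrow> bool" where
  "is_norm nrm \<longleftrightarrow>
     (\<forall>w. nrm w = 0 \<longleftrightarrow> w = 0) \<and>
     (\<forall>a w. nrm (a *\<^sub>R w) = \<bar>a\<bar> * nrm w) \<and>
     (\<forall>w w'. nrm (w + w') \<le> nrm w + nrm w')"

definition dual_norm :: "('a::euclidean_space \<Rightarrow> real) \<Rightarrow> 'a \<Rightarrow> real" where
  "dual_norm nrm z = Sup {z \<bullet> w | w. nrm w \<le> 1}"

text \<open>The truncation of \<^const>\<open>e2ennreal\<close> at zero yields the positive and the negative part.
  If both parts have infinite integral, the value is \<open>\<infinity>\<close>; this cannot happen for a
  function with an affine upper bound and a distribution with finite first moment.\<close>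

definition ereal_expectation :: "'a measure \<Rightarrow> ('a \<Rightarrow> ereal) \<Rightarrow> ereal" where
  "ereal_expectation M u =
     enn2ereal (\<integral>\<^sup>+ w. e2ennreal (u w) \<partial>M) - enn2ereal (\<integral>\<^sup>+ w. e2ennreal (- u w) \<partial>M)"

definition prob_measures_on :: "'a::topological_space set \<Rightarrow> 'a measure set" where
  "prob_measures_on S = {Q. sets Q = sets borel \<and> prob_space Q \<and> emeasure Q S = 1}"

text \<open>The measure \<open>\<Sum>j\<in>J. p j * Q j\<close> for finite \<open>J\<close> and nonnegative weights.\<close>

definition mixture :: "'j set \<Rightarrow> ('j \<Rightarrow> real) \<Rightarrow> ('j \<Rightarrow> 'a measure) \<Rightarrow> 'a::topological_space measure"
  where "mixture J p Q =
    measure_of UNIV (sets borel) (\<lambda>A. \<Sum>j\<in>J. ennreal (p j) * emeasure (Q j) A)"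

lemma sets_mixture [simp, measurable_cong]: "sets (mixture J p Q) = sets borel"
  unfolding mixture_def
  by (metis sets.sigma_sets_eq sets_measure_of space_borel subset_UNIV Pow_UNIV)

lemma emeasure_mixture:
  assumes "finite J" and "\<And>j. j \<in> J \<Longrightarrow> sets (Q j) = sets borel" and "A \<in> sets borel"
  shows "emeasure (mixture J p Q) A = (\<Sum>j\<in>J. ennreal (p j) * emeasure (Q j) A)"
proof (rule emeasure_measure_of[OF mixture_def])
  show "countably_additive (sets (mixture J p Q)) (\<lambda>A. \<Sum>j\<in>J. ennreal (p j) * emeasure (Q j) A)"
  proof (rule countably_additiveI)
    fix B :: "nat \<Rightarrow> 'b set"
    assume B: "range B \<subseteq> sets (mixture J p Q)" "disjoint_family B"
    have "(\<Sum>n. emeasure (Q j) (B n)) = emeasure (Q j) (\<Union>n. B n)" if "j \<in> J" for j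
      using B assms(2)[OF that] by (intro suminf_emeasure) auto
    then show "(\<Sum>n. \<Sum>j\<in>J. ennreal (p j) * emeasure (Q j) (B n)) =
        (\<Sum>j\<in>J. ennreal (p j) * emeasure (Q j) (\<Union>n. B n))"
      by (subst suminf_sum) auto
  qed
qed (use assms in \<open>auto simp: positive_def\<close>)

definition couplings :: "'a::topological_space set \<Rightarrow> 'a measure \<Rightarrow> 'a measure \<Rightarrow> ('a \<times> 'a) measure set"
  where "couplings \<Xi> Q P =
    {\<pi> \<in> prob_measures_on (\<Xi> \<times> \<Xi>). distr \<pi> borel fst = Q \<and> distr \<pi> borel snd = P}"

definition wasserstein ::
  "('a::euclidean_space \<Rightarrow> real) \<Rightarrow> 'a set \<Rightarrow> 'a measure \<Rightarrow> 'a measure \<Rightarrow> ennreal" where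
  "wasserstein nrm \<Xi> Q P = (INF \<pi>\<in>couplings \<Xi> Q P. \<integral>\<^sup>+ (x, y). ennreal (nrm (x - y)) \<partial>\<pi>)"

definition wasserstein_ball ::
  "('a::euclidean_space \<Rightarrow> real) \<Rightarrow> 'a set \<Rightarrow> 'a measure \<Rightarrow> real \<Rightarrow> 'a measure set" where
  "wasserstein_ball nrm \<Xi> P \<theta> = {Q \<in> prob_measures_on \<Xi>. wasserstein nrm \<Xi> Q P \<le> ennreal \<theta>}"

text \<open>The data points are indexed by the finite type \<open>'l\<close>, so that repeated points are counted with
  multiplicity, and a labelling \<open>c :: 'l \<Rightarrow> 'k\<close> describes the partition into clusters.\<close>

definition cluster :: "('l::finite \<Rightarrow> 'k) \<Rightarrow> 'k \<Rightarrow> 'l set" where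
  "cluster c k = {l. c l = k}"

definition empirical :: "('l::finite \<Rightarrow> 'a::topological_space) \<Rightarrow> ('l \<Rightarrow> 'k) \<Rightarrow> 'k \<Rightarrow> 'a measure" where
  "empirical data c k =
     mixture (cluster c k) (\<lambda>l. 1 / real (card (cluster c k))) (\<lambda>l. return borel (data l))"

definition ambiguity_set ::
  "('a::euclidean_space \<Rightarrow> real) \<Rightarrow> 'a set \<Rightarrow> ('l::finite \<Rightarrow> 'a) \<Rightarrow> ('l \<Rightarrow> 'k::finite) \<Rightarrow> ('k \<Rightarrow> real)
    \<Rightarrow> 'a measure set" where
  "ambiguity_set nrm \<Xi> data c \<theta> =
     {mixture UNIV (\<lambda>k. real (card (cluster c k)) / real CARD('l)) Q | Q.
        \<forall>k. Q k \<in> wasserstein_ball nrm \<Xi> (empirical data c k) (\<theta> k)}"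

text \<open>A point of the decision space is a tuple \<open>(x, \<lambda>, \<alpha>, z, v)\<close>, where \<open>z $ l $ i\<close> and \<open>v $ l $ i\<close>
  are the vectors belonging to the data point \<open>l\<close> and the piece \<open>i\<close>. This is a Euclidean space.\<close>

type_synonym ('n, 'm, 'k, 'l, 'i) decision =
  "(real, 'n) vec \<times> (real, 'k) vec \<times> (real, 'l) vec
    \<times> (((real, 'm) vec, 'i) vec, 'l) vec \<times> (((real, 'm) vec, 'i) vec, 'l) vec"

definition reform_objective ::
  "(real^'n \<Rightarrow> ereal) \<Rightarrow> ('l::finite \<Rightarrow> 'k::finite) \<Rightarrow> ('k \<Rightarrow> real)
    \<Rightarrow> ('n::finite, 'm::finite, 'k, 'l, 'i::finite) decision \<Rightarrow> ereal" where
  "reform_objective f c \<theta> = (\<lambda>(x, lam, \<alpha>, z, v).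
     f x + ereal (\<Sum>k\<in>UNIV. real (card (cluster c k)) / real CARD('l) *
       (lam $ k * \<theta> k + (\<Sum>l\<in>cluster c k. \<alpha> $ l / real (card (cluster c k))))))"

definition reform_feasible ::
  "(real^'n) set \<Rightarrow> (real^'m) set \<Rightarrow> (real^'m \<Rightarrow> real) \<Rightarrow> ('l::finite \<Rightarrow> real^'m) \<Rightarrow> ('l \<Rightarrow> 'k::finite)
    \<Rightarrow> ('i::finite \<Rightarrow> real^'n \<Rightarrow> real^'m \<Rightarrow> ereal)
    \<Rightarrow> ('n::finite, 'm::finite, 'k, 'l, 'i) decision set" where
  "reform_feasible X \<Xi> nrm data c h = {(x, lam, \<alpha>, z, v).
     (\<forall>l i. ereal (\<alpha> $ l) \<ge> conjugate_on \<Xi> (\<lambda>w. - h i x w) (z $ l $ i - v $ l $ i)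
              + support_fun \<Xi> (v $ l $ i) - ereal (z $ l $ i \<bullet> data l)) \<and>
     (\<forall>k. \<forall>l\<in>cluster c k. \<forall>i. dual_norm nrm (z $ l $ i) \<le> lam $ k) \<and>
     x \<in> X \<and> (\<forall>k. lam $ k \<ge> 0)}"

text \<open>The constraint functions of the reformulation, each constraint being brought into
  the form \<open>constraint function \<le> 0\<close>.\<close>

definition reform_constraints ::
  "(real^'m) set \<Rightarrow> (real^'m \<Rightarrow> real) \<Rightarrow> ('l::finite \<Rightarrow> real^'m) \<Rightarrow> ('l \<Rightarrow> 'k::finite)
    \<Rightarrow> ('i::finite \<Rightarrow> real^'n \<Rightarrow> real^'m \<Rightarrow> ereal)
    \<Rightarrow> (('n::finite, 'm::finite, 'k, 'l, 'i) decision \<Rightarrow> ereal) set" where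
  "reform_constraints \<Xi> nrm data c h =
     {(\<lambda>(x, lam, \<alpha>, z, v). conjugate_on \<Xi> (\<lambda>w. - h i x w) (z $ l $ i - v $ l $ i)
          + support_fun \<Xi> (v $ l $ i) - ereal (z $ l $ i \<bullet> data l) - ereal (\<alpha> $ l)) | l i. True} \<union>
     {(\<lambda>(x, lam, \<alpha>, z, v). ereal (dual_norm nrm (z $ l $ i) - lam $ k)) | k l i. l \<in> cluster c k} \<union>
     {(\<lambda>(x, lam, \<alpha>, z, v). ereal (- lam $ k)) | k. True}"

text \<open>The program of minimising \<open>obj\<close> over the points of \<open>S\<close> at which all functions in \<open>C\<close>
  are nonpositive.\<close>

definition program_feasible :: "'v set \<Rightarrow> ('v \<Rightarrow> ereal) set \<Rightarrow> 'v set" where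
  "program_feasible S C = {d \<in> S. \<forall>q\<in>C. q d \<le> 0}"

definition finite_convex_program ::
  "'v::euclidean_space set \<Rightarrow> ('v \<Rightarrow> ereal) \<Rightarrow> ('v \<Rightarrow> ereal) set \<Rightarrow> bool" where
  "finite_convex_program S obj C \<longleftrightarrow>
     convex S \<and> ereal_convex obj \<and> finite C \<and> (\<forall>q\<in>C. ereal_convex q)"

end

theory Submission
  imports Defs
begin

text \<open>Weak duality integrates a bound \<open>u w \<le> \<alpha> l + \<lambda> * nrm (w - data l)\<close> against a nearly optimal coupling.
  For strong duality in one cluster, every assignment \<open>w\<close> of data points to points where \<open>u\<close> is finite
  yields a pair (average cost, average loss). The convex hull of these pairs is realised by measures in
  the Wasserstein ball, so it avoids the quadrant cost \<open>\<le> \<theta>\<close>, loss \<open>> M\<close>, and a separating line in the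
  plane gives the multiplier \<open>\<lambda>\<close>. If that line is vertical, \<open>u\<close> may be infinite at the data and \<open>\<theta>\<close> is
  at most the cost of reaching its domain; upper semicontinuity then makes a sufficiently large \<open>\<lambda>\<close> work.

  Each inequality \<open>h i x w \<le> \<alpha> l + \<lambda> * nrm (w - data l)\<close> puts a concave function below a convex one.
  The slope of an affine function in between is \<open>- z\<close> with dual norm at most \<open>\<lambda>\<close>, which is the conjugate
  constraint with \<open>v = 0\<close>; the variable \<open>v\<close> is redundant because the conjugate is taken over \<open>\<Xi>\<close> already.\<close>

subsection \<open>Norms\<close>

text \<open>A bound on the supremum controls only averages over a cluster and weighted sums over
  clusters, while the constraints of the reformulation are local to one data point. The bridge is
  independence: transport targets of different data points, and distributions of different clusters,
  are chosen independently of each other, so a bound on all joint choices splits into one bound for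
  each index. The infimum over the dual variables need not be attained, since it may be approached
  only as \<open>lam\<close> grows. Strong duality therefore carries a slack \<open>e\<close>, which
  disappears when optimal values are compared. The pieces may be \<open>-\<infinity>\<close>, even
  at all data points, so a positive radius is no Slater condition by itself. Real-valued sums are
  taken only over points where the loss is finite, and affine majorants of the pieces keep positive
  parts integrable, so that \<open>\<infinity> - \<infinity>\<close> does not arise in the
  expectations.\<close>

lemma is_norm_zero [simp]: "is_norm nrm \<Longrightarrow> nrm 0 = 0"
  by (simp add: is_norm_def)

lemma is_norm_scale: "is_norm nrm \<Longrightarrow> nrm (a *\<^sub>R w) = \<bar>a\<bar> * nrm w"
  by (simp add: is_norm_def)

lemma is_norm_triangle: "is_norm nrm \<Longrightarrow> nrm (w + w') \<le> nrm w + nrm w'"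
  by (simp add: is_norm_def)

lemma is_norm_minus: "is_norm nrm \<Longrightarrow> nrm (- w) = nrm w"
  using is_norm_scale[of nrm "-1" w] by simp

lemma is_norm_nonneg:
  assumes "is_norm nrm" shows "0 \<le> nrm w"
  using is_norm_triangle[OF assms, of w "- w"] is_norm_minus[OF assms, of w] assms by simp

lemma is_norm_pos:
  assumes "is_norm nrm" "w \<noteq> 0" shows "0 < nrm w"
  using is_norm_nonneg[OF assms(1), of w] assms by (auto simp: is_norm_def less_le)

lemma is_norm_convex_on:
  assumes "is_norm nrm" shows "convex_on UNIV nrm"
proof (rule convex_onI)
  fix t x y assume "0 < (t::real)" "t < 1"
  then show "nrm ((1 - t) *\<^sub>R x + t *\<^sub>R y) \<le> (1 - t) * nrm x + t * nrm y"
    using is_norm_triangle[OF assms, of "(1 - t) *\<^sub>R x" "t *\<^sub>R y"] by (simp add: is_norm_scale[OF assms])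
qed auto

text \<open>A finite convex function on an open subset of a Euclidean space is continuous.\<close>

lemma is_norm_continuous_on:
  fixes nrm :: "'a::euclidean_space \<Rightarrow> real"
  assumes "is_norm nrm" shows "continuous_on S nrm"
  using convex_on_continuous[OF open_UNIV is_norm_convex_on[OF assms]] continuous_on_subset by blast

lemma is_norm_continuous_on_diff:
  fixes nrm :: "'a::euclidean_space \<Rightarrow> real"
  assumes "is_norm nrm" shows "continuous_on S (\<lambda>w. nrm (w - y))"
  by (rule continuous_on_compose2[OF is_norm_continuous_on[OF assms, of UNIV]]) (auto intro: continuous_intros)

text \<open>The constant is the reciprocal of the minimum of \<open>nrm\<close> on the Euclidean
  unit sphere, attained by compactness and positive by definiteness. It serves to bound the dual
  norm, to make \<open>nrm\<close>-balls bounded, and to turn Euclidean growth estimates into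
  estimates in \<open>nrm\<close>.\<close>

lemma is_norm_dominates:
  fixes nrm :: "'a::euclidean_space \<Rightarrow> real"
  assumes "is_norm nrm"
  obtains c where "c > 0" "\<And>w. norm w \<le> c * nrm w"
proof -
  obtain b :: 'a where "b \<in> sphere 0 1" using vector_choose_size[of 1] by auto
  then obtain u :: 'a where u: "u \<in> sphere 0 1" "\<And>w. w \<in> sphere 0 1 \<Longrightarrow> nrm u \<le> nrm w"
    using continuous_attains_inf[OF compact_sphere _ is_norm_continuous_on[OF assms]] by blast
  have "u \<noteq> 0" using u(1) by auto
  then have pos: "nrm u > 0" by (rule is_norm_pos[OF assms])
  have "norm w \<le> 1 / nrm u * nrm w" for w
  proof (cases "w = 0")
    case False
    have "nrm u \<le> nrm ((1 / norm w) *\<^sub>R w)" using False by (intro u) auto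
    also have "\<dots> = nrm w / norm w" by (simp add: is_norm_scale[OF assms])
    finally show ?thesis using False pos by (simp add: field_simps)
  qed (simp add: assms)
  with pos show ?thesis by (intro that[of "1 / nrm u"]) auto
qed

section \<open>The dual norm\<close>

lemma dual_norm_bdd_above:
  fixes nrm :: "'a::euclidean_space \<Rightarrow> real"
  assumes "is_norm nrm" shows "bdd_above {z \<bullet> w | w. nrm w \<le> 1}"
proof -
  obtain c where c: "c > 0" "\<And>w. norm w \<le> c * nrm w" using is_norm_dominates[OF assms] by blast
  have "z \<bullet> w \<le> norm z * c" if "nrm w \<le> 1" for w
  proof -
    have "z \<bullet> w \<le> norm z * norm w" by (rule norm_cauchy_schwarz)
    also have "norm w \<le> c" using c(2)[of w] c(1) that mult_left_mono[of "nrm w" 1 c] by linarith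
    finally show ?thesis by (simp add: mult_left_mono)
  qed
  then show ?thesis by (intro bdd_aboveI) auto
qed

lemma inner_le_dual_norm:
  fixes nrm :: "'a::euclidean_space \<Rightarrow> real"
  assumes "is_norm nrm" shows "z \<bullet> w \<le> dual_norm nrm z * nrm w"
proof (cases "w = 0")
  case False
  have pos: "0 < nrm w" by (rule is_norm_pos[OF assms False])
  have "z \<bullet> ((1 / nrm w) *\<^sub>R w) \<le> dual_norm nrm z"
    unfolding dual_norm_def
  proof (intro cSup_upper dual_norm_bdd_above[OF assms] CollectI exI conjI)
    show "nrm ((1 / nrm w) *\<^sub>R w) \<le> 1" using pos by (simp add: is_norm_scale[OF assms])
  qed simp
  with pos show ?thesis by (simp add: field_simps)
qed (simp add: assms)

text \<open>Converse to \<open>inner_le_dual_norm\<close>: the dual norm is the least nonnegative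
  multiplier in that inequality. Its convexity and the bound on a separating slope thus reduce to
  linear inequalities.\<close>

lemma dual_norm_le:
  fixes nrm :: "'a::euclidean_space \<Rightarrow> real"
  assumes "is_norm nrm" "0 \<le> lam" "\<And>w. z \<bullet> w \<le> lam * nrm w"
  shows "dual_norm nrm z \<le> lam"
  unfolding dual_norm_def
proof (rule cSup_least)
  show "{z \<bullet> w | w. nrm w \<le> 1} \<noteq> {}" using assms(1) by (auto intro: exI[of _ 0])
  fix r assume "r \<in> {z \<bullet> w | w. nrm w \<le> 1}"
  then obtain w where "r = z \<bullet> w" "nrm w \<le> 1" by auto
  then show "r \<le> lam" using assms(3)[of w] mult_left_mono[of "nrm w" 1 lam] assms(2) by auto
qed

lemma dual_norm_nonneg:
  fixes nrm :: "'a::euclidean_space \<Rightarrow> real"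
  assumes "is_norm nrm" shows "0 \<le> dual_norm nrm z"
  unfolding dual_norm_def
  by (rule cSup_upper[OF _ dual_norm_bdd_above[OF assms]]) (use assms in \<open>auto intro: exI[of _ 0]\<close>)

lemma dual_norm_convex:
  fixes nrm :: "'a::euclidean_space \<Rightarrow> real"
  assumes "is_norm nrm" "0 \<le> a" "0 \<le> b"
  shows "dual_norm nrm (a *\<^sub>R x + b *\<^sub>R y) \<le> a * dual_norm nrm x + b * dual_norm nrm y"
proof (rule dual_norm_le[OF assms(1)])
  show "0 \<le> a * dual_norm nrm x + b * dual_norm nrm y"
    using assms dual_norm_nonneg[OF assms(1)] by simp
  fix w
  show "(a *\<^sub>R x + b *\<^sub>R y) \<bullet> w \<le> (a * dual_norm nrm x + b * dual_norm nrm y) * nrm w"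
    using mult_left_mono[OF inner_le_dual_norm[OF assms(1), of x w] assms(2)]
      mult_left_mono[OF inner_le_dual_norm[OF assms(1), of y w] assms(3)]
    by (simp add: inner_add_left algebra_simps)
qed

subsection \<open>Extended-real convexity\<close>

lemma ereal_convexI:
  assumes "\<And>x y r s a b. u x \<le> ereal r \<Longrightarrow> u y \<le> ereal s \<Longrightarrow> 0 \<le> a \<Longrightarrow> 0 \<le> b \<Longrightarrow> a + b = 1 \<Longrightarrow>
    u (a *\<^sub>R x + b *\<^sub>R y) \<le> ereal (a * r + b * s)"
  shows "ereal_convex u"
  unfolding ereal_convex_def convex_def using assms by auto

lemma ereal_convexD:
  assumes "ereal_convex u" "u x \<le> ereal r" "u y \<le> ereal s" "0 \<le> a" "0 \<le> b" "a + b = 1"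
  shows "u (a *\<^sub>R x + b *\<^sub>R y) \<le> ereal (a * r + b * s)"
  using assms(1)[unfolded ereal_convex_def convex_def, rule_format, of "(x,r)" "(y,s)" a b] assms(2-)
  by auto

section \<open>Hypographs and affine majorants of concave functions\<close>

lemma convex_hypograph:
  assumes "ereal_concave u" shows "convex {(w, r). ereal r \<le> u w}"
  unfolding convex_def
proof clarsimp
  fix w r w' r' and a b :: real
  assume *: "ereal r \<le> u w" "ereal r' \<le> u w'" "0 \<le> a" "0 \<le> b" "a + b = 1"
  have "- u (a *\<^sub>R w + b *\<^sub>R w') \<le> ereal (a * (- r) + b * (- r'))"
    using assms * unfolding ereal_concave_def
    by (intro ereal_convexD[where u = "\<lambda>x. - u x"])
       (simp_all, (metis ereal_minus_le_minus uminus_ereal.simps(1))+)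
  then show "ereal (a * r + b * r') \<le> u (a *\<^sub>R w + b *\<^sub>R w')"
    by (metis ereal_minus_le_minus minus_add_distrib mult_minus_right uminus_ereal.simps(1))
qed

lemma closed_upper_level_set:
  assumes "upper_semicontinuous u" shows "closed {w. a \<le> u w}"
proof -
  have "open {w. u w < a}"
  proof (subst open_subopen, intro ballI)
    fix w assume "w \<in> {w. u w < a}"
    then have "\<forall>\<^sub>F y in nhds w. u y < a" using assms by (auto simp: upper_semicontinuous_def)
    then show "\<exists>T. open T \<and> w \<in> T \<and> T \<subseteq> {w. u w < a}"
      unfolding eventually_nhds by (auto simp: subset_iff)
  qed
  moreover have "- {w. a \<le> u w} = {w. u w < a}" by auto
  ultimately show ?thesis by (simp add: closed_def)
qed

text \<open>A point \<open>(w, r)\<close> lies in the hypograph iff every real \<open>s\<close>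
  satisfies \<open>s \<le> u w\<close> or \<open>r \<le> s\<close>. For fixed \<open>s\<close> this
  is a union of two closed cylinders, one over an upper level set, so the hypograph is an
  intersection of closed sets.\<close>

lemma closed_hypograph:
  assumes "upper_semicontinuous u" shows "closed {(w, r). ereal r \<le> u w}"
proof -
  have iff: "ereal r \<le> u w \<longleftrightarrow> (\<forall>s. ereal s \<le> u w \<or> r \<le> s)" for w r
  proof
    assume *: "\<forall>s. ereal s \<le> u w \<or> r \<le> s"
    show "ereal r \<le> u w"
    proof (rule dense_le)
      fix e assume "e < ereal r"
      then show "e \<le> u w" using * by (cases e) (auto simp: not_le[symmetric])
    qed
  next
    assume "ereal r \<le> u w"
    then have "ereal s \<le> u w" if "s \<le> r" for s using that by (meson ereal_less_eq(3) order_trans)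
    then show "\<forall>s. ereal s \<le> u w \<or> r \<le> s" by (meson linear)
  qed
  have eq: "{(w, r). ereal r \<le> u w} = (\<Inter>s. {w. ereal s \<le> u w} \<times> UNIV \<union> UNIV \<times> {..s})"
  proof (rule set_eqI)
    fix x show "x \<in> {(w, r). ereal r \<le> u w} \<longleftrightarrow> x \<in> (\<Inter>s. {w. ereal s \<le> u w} \<times> UNIV \<union> UNIV \<times> {..s})"
      using iff[of "snd x" "fst x"] by (cases x) simp
  qed
  show ?thesis
    unfolding eq by (intro closed_INT ballI closed_Un closed_Times closed_upper_level_set[OF assms]) simp_all
qed

lemma upper_semicontinuous_measurable:
  assumes "upper_semicontinuous u" shows "u \<in> borel_measurable borel"
  by (rule borel_measurableI_ge) (simp add: closed_upper_level_set[OF assms])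

text \<open>A point just above a finite value of \<open>u\<close> lies outside the closed convex
  hypograph. The strictly separating hyperplane, solved for the last coordinate, is the
  majorant.\<close>

lemma concave_usc_affine_majorant:
  fixes u :: "'a::euclidean_space \<Rightarrow> ereal"
  assumes "ereal_concave u" "upper_semicontinuous u" "\<And>w. u w < \<infinity>"
  obtains y b where "\<And>w. u w \<le> ereal (y \<bullet> w + b)"
proof (cases "\<exists>w0. u w0 > - \<infinity>")
  case False
  then show ?thesis by (intro that[of 0 0]) (metis ereal_infty_less(2) bot.extremum bot_ereal_def)
next
  case True
  then obtain w0 r0 where w0: "u w0 = ereal r0" using assms(3) by (metis ereal_cases less_irrefl)
  let ?S = "{(w, r). ereal r \<le> u w}"
  have "(w0, r0 + 1) \<notin> ?S" using w0 by auto
  then obtain p b where pb: "p \<bullet> (w0, r0 + 1) < b" "\<And>x. x \<in> ?S \<Longrightarrow> p \<bullet> x > b"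
    using separating_hyperplane_closed_point[OF convex_hypograph[OF assms(1)] closed_hypograph[OF assms(2)]]
    by metis
  obtain y s where p: "p = (y, s)" by force
  \<comment> \<open>The hyperplane is not vertical: it separates two points over the same
    \<open>w0\<close>, the upper one at height \<open>r0 + 1\<close> and the lower one at
    \<open>r0\<close>.\<close>
  have "s < 0" using pb(1) pb(2)[of "(w0, r0)"] w0 by (auto simp: p algebra_simps)
  show ?thesis
  proof (rule that[of "(- 1 / s) *\<^sub>R y" "b / s"])
    fix w
    show "u w \<le> ereal ((- 1 / s) *\<^sub>R y \<bullet> w + b / s)"
    proof (cases "u w")
      case (real r)
      then have "y \<bullet> w + s * r > b" using pb(2)[of "(w, r)"] by (simp add: p)
      with \<open>s < 0\<close> real show ?thesis by (simp add: field_simps)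
    qed (use assms(3)[of w] in auto)
  qed
qed

section \<open>Operations preserving convexity\<close>

lemma ereal_convex_add:
  assumes "ereal_convex u" "ereal_convex v" shows "ereal_convex (\<lambda>x. u x + v x)"
proof (rule ereal_convexI)
  \<comment> \<open>By the convention \<open>\<infinity> + (-\<infinity>) = \<infinity>\<close>, a
    real bound on the sum keeps both summands below \<open>\<infinity>\<close>, so it splits into
    real bounds on the summands.\<close>
  have split: "\<exists>r s. p \<le> ereal r \<and> q \<le> ereal s \<and> r + s = t" if "p + q \<le> ereal t" for p q t
  proof (cases p q rule: ereal2_cases)
    case (real_real r s)
    then show ?thesis using that by (intro exI[of _ r] exI[of _ "t - r"]) auto
  next
    case (real_MInf r)
    then show ?thesis by (intro exI[of _ r] exI[of _ "t - r"]) auto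
  next
    case (MInf_real s)
    then show ?thesis by (intro exI[of _ "t - s"] exI[of _ s]) auto
  next
    case MInf_MInf
    then show ?thesis by (intro exI[of _ t] exI[of _ 0]) auto
  qed (use that in auto)
  fix x y r s and a b :: real
  assume *: "u x + v x \<le> ereal r" "u y + v y \<le> ereal s" "0 \<le> a" "0 \<le> b" "a + b = 1"
  obtain r1 r2 where r: "u x \<le> ereal r1" "v x \<le> ereal r2" "r1 + r2 = r" using split[OF *(1)] by blast
  obtain s1 s2 where s: "u y \<le> ereal s1" "v y \<le> ereal s2" "s1 + s2 = s" using split[OF *(2)] by blast
  have "u (a *\<^sub>R x + b *\<^sub>R y) + v (a *\<^sub>R x + b *\<^sub>R y) \<le> ereal (a * r1 + b * s1) + ereal (a * r2 + b * s2)"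
    using r s * assms by (intro add_mono ereal_convexD) auto
  then show "u (a *\<^sub>R x + b *\<^sub>R y) + v (a *\<^sub>R x + b *\<^sub>R y) \<le> ereal (a * r + b * s)"
    unfolding r(3)[symmetric] s(3)[symmetric] by (simp add: algebra_simps)
qed

lemma ereal_convex_compose_linear:
  assumes "linear L" "ereal_convex u" shows "ereal_convex (\<lambda>x. u (L x))"
  by (rule ereal_convexI) (simp add: linear_add[OF assms(1)] linear_scale[OF assms(1)] ereal_convexD[OF assms(2)])

lemma ereal_convex_SUP:
  assumes "\<And>i. i \<in> I \<Longrightarrow> ereal_convex (u i)" shows "ereal_convex (\<lambda>x. SUP i\<in>I. u i x)"
  by (rule ereal_convexI) (auto simp: SUP_le_iff intro!: ereal_convexD[OF assms])

lemma ereal_convex_linear: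
  assumes "linear \<phi>" shows "ereal_convex (\<lambda>x. ereal (\<phi> x))"
  by (rule ereal_convexI)
     (simp add: linear_add[OF assms] linear_scale[OF assms] add_mono mult_left_mono)

lemma ereal_convex_dual_norm:
  fixes nrm :: "'a::euclidean_space \<Rightarrow> real"
  assumes "is_norm nrm" shows "ereal_convex (\<lambda>z. ereal (dual_norm nrm z))"
proof (rule ereal_convexI)
  fix x y r s and a b :: real
  assume *: "ereal (dual_norm nrm x) \<le> ereal r" "ereal (dual_norm nrm y) \<le> ereal s" "0 \<le> a" "0 \<le> b"
  have "dual_norm nrm (a *\<^sub>R x + b *\<^sub>R y) \<le> a * dual_norm nrm x + b * dual_norm nrm y"
    using * by (intro dual_norm_convex assms)
  also have "\<dots> \<le> a * r + b * s" using * by (intro add_mono mult_left_mono) auto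
  finally show "ereal (dual_norm nrm (a *\<^sub>R x + b *\<^sub>R y)) \<le> ereal (a * r + b * s)" by simp
qed

lemma ereal_convex_support_fun: "ereal_convex (support_fun \<Xi>)"
  unfolding support_fun_def
  by (intro ereal_convex_SUP ereal_convex_linear) (auto intro!: linearI simp: inner_add_left)

text \<open>Convexity is joint in the decision and the dual vector: for each \<open>w\<close> the
  term under the supremum is linear in \<open>z\<close> plus a function convex in
  \<open>x\<close>.\<close>

lemma ereal_convex_conjugate_on:
  fixes u :: "'b::real_vector \<Rightarrow> 'a::real_inner \<Rightarrow> ereal"
  assumes "\<And>w. ereal_convex (\<lambda>x. u x w)"
  shows "ereal_convex (\<lambda>(x, z). conjugate_on \<Xi> (\<lambda>w. - u x w) z)"
proof -
  have "ereal_convex (\<lambda>d. SUP w\<in>\<Xi>. ereal (snd d \<bullet> w) + u (fst d) w)"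
  proof (intro ereal_convex_SUP ereal_convex_add)
    fix w :: 'a
    show "ereal_convex (\<lambda>d. ereal (snd d \<bullet> w))"
      by (intro ereal_convex_linear) (auto intro!: linearI simp: inner_add_left)
    show "ereal_convex (\<lambda>d. u (fst d) w)"
      by (rule ereal_convex_compose_linear[OF linear_fst assms])
  qed
  then show ?thesis
    unfolding conjugate_on_def by (simp add: case_prod_unfold minus_ereal_def)
qed

subsection \<open>The conjugate constraints\<close>

text \<open>The hypograph of \<open>u\<close> over \<Xi> and the epigraph of the norm cone with apex
  at \<open>y\<close> are separated by a hyperplane. It is not vertical because the cone lies over
  the whole space, and homogeneity of the cone about its apex bounds the slope by \<open>lam\<close>
  in the dual norm.\<close>

lemma concave_norm_sandwich:
  fixes nrm :: "'a::euclidean_space \<Rightarrow> real"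
  assumes nrm: "is_norm nrm" and u: "ereal_concave u" and \<Xi>: "convex \<Xi>" and lam: "0 \<le> lam"
    and le: "\<And>w. w \<in> \<Xi> \<Longrightarrow> u w \<le> ereal (a + lam * nrm (w - y))"
  obtains z where "dual_norm nrm z \<le> lam" "\<And>w. w \<in> \<Xi> \<Longrightarrow> u w \<le> ereal (a - z \<bullet> (w - y))"
proof -
  let ?S = "{(w, r). ereal r \<le> u w} \<inter> \<Xi> \<times> UNIV"
  \<comment> \<open>The strict epigraph stays disjoint from the hypograph even where the two
    functions touch.\<close>
  let ?T = "{(w, r). a + lam * nrm (w - y) < r}"
  show ?thesis
  proof (cases "?S = {}")
    case True
    \<comment> \<open>An empty hypograph means that \<open>u\<close> is \<open>-\<infinity>\<close>
      on \<Xi>, so slope 0 works.\<close>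
    then have "\<not> ereal r \<le> u w" if "w \<in> \<Xi>" for w r using that by auto
    then have "u w \<le> ereal r" if "w \<in> \<Xi>" for w r using that by (meson linear)
    then show ?thesis using lam by (intro that[of 0] dual_norm_le[OF nrm]) (auto intro!: mult_nonneg_nonneg is_norm_nonneg[OF nrm])
  next
    case False
    have "convex ?T"
    proof -
      have eq: "?T = {(w, r). (\<lambda>w. a + lam * nrm (w - y)) w < r}" by simp
      have "convex_on UNIV (\<lambda>w. nrm (w - y))"
      proof (rule convex_onI)
        fix t p q assume t: "0 < (t::real)" "t < 1"
        have "(1 - t) *\<^sub>R p + t *\<^sub>R q - y = (1 - t) *\<^sub>R (p - y) + t *\<^sub>R (q - y)" by (simp add: algebra_simps)
        then show "nrm ((1 - t) *\<^sub>R p + t *\<^sub>R q - y) \<le> (1 - t) * nrm (p - y) + t * nrm (q - y)"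
          using convex_onD[OF is_norm_convex_on[OF nrm], of t "p - y" "q - y"] t by simp
      qed auto
      note convex = convex_onD[OF this]
      show ?thesis
        unfolding convex_def
      proof clarsimp
        fix w r w' r' and p q :: real
        assume *: "a + lam * nrm (w - y) < r" "a + lam * nrm (w' - y) < r'" "0 \<le> p" "0 \<le> q" "p + q = 1"
        have "nrm (p *\<^sub>R w + q *\<^sub>R w' - y) \<le> p * nrm (w - y) + q * nrm (w' - y)"
          using convex[of q w w'] * by (simp add: eq_diff_eq[THEN iffD2, OF *(5)])
        then have "a + lam * nrm (p *\<^sub>R w + q *\<^sub>R w' - y) \<le> a + lam * (p * nrm (w - y) + q * nrm (w' - y))"
          using lam by (simp add: mult_left_mono)
        also have "\<dots> = p * (a + lam * nrm (w - y)) + q * (a + lam * nrm (w' - y))"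
        proof -
          have "p * (a + lam * nrm (w - y)) + q * (a + lam * nrm (w' - y)) =
              (p + q) * a + lam * (p * nrm (w - y) + q * nrm (w' - y))"
            by (simp add: algebra_simps)
          then show ?thesis using *(5) by simp
        qed
        also have "\<dots> < p * r + q * r'" using *
          by (cases "p = 0") (auto intro!: add_less_le_mono mult_left_mono)
        finally show "a + lam * nrm (p *\<^sub>R w + q *\<^sub>R w' - y) < p * r + q * r'" .
      qed
    qed
    moreover have "convex ?S" by (intro convex_Int convex_hypograph u convex_Times \<Xi> convex_UNIV)
    moreover have "?S \<inter> ?T = {}"
    proof -
      have False if "ereal r \<le> u w" "w \<in> \<Xi>" "a + lam * nrm (w - y) < r" for w r
        using that(1,3) order_trans[OF that(1) le[OF that(2)]] by simp
      then show ?thesis by auto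
    qed
    moreover have "(y, a + lam * nrm (y - y) + 1) \<in> ?T" by simp
    then have "?T \<noteq> {}" by blast
    ultimately obtain p b where p: "p \<noteq> 0" "\<And>x. x \<in> ?S \<Longrightarrow> p \<bullet> x \<le> b" "\<And>x. x \<in> ?T \<Longrightarrow> b \<le> p \<bullet> x"
      using separating_hyperplane_sets[of ?S ?T] False by metis
    obtain q s where ps: "p = (q, s)" by force
    have S: "q \<bullet> w + s * r \<le> b" if "ereal r \<le> u w" "w \<in> \<Xi>" for w r
      using p(2)[of "(w, r)"] that by (simp add: ps)
    have T: "b \<le> q \<bullet> w + s * (a + lam * nrm (w - y) + e)" if "0 < e" for w e
      using p(3)[of "(w, a + lam * nrm (w - y) + e)"] that by (simp add: ps)
    have "0 \<le> s"
    proof (rule ccontr)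
      assume "\<not> 0 \<le> s"
      define e where "e = (\<bar>b\<bar> + \<bar>q \<bullet> y\<bar> + \<bar>s * a\<bar> + 1) / - s"
      have e: "0 < e" "s * e = - (\<bar>b\<bar> + \<bar>q \<bullet> y\<bar> + \<bar>s * a\<bar> + 1)"
        using \<open>\<not> 0 \<le> s\<close> by (auto simp: e_def field_simps intro!: divide_pos_pos)
      show False using T[OF e(1), of y] e(2) nrm by (simp add: algebra_simps)
    qed
    \<comment> \<open>A vertical hyperplane would bound the linear functional of \<open>q\<close>
      below on the whole space, so \<open>q\<close> would vanish as well.\<close>
    have "s \<noteq> 0"
    proof
      assume "s = 0"
      then have *: "b \<le> q \<bullet> w" for w using T[of 1 w] by simp
      have "q \<bullet> q = 0"
      proof (rule ccontr)
        assume "q \<bullet> q \<noteq> 0"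
        then show False using *[of "((b - 1) / (q \<bullet> q)) *\<^sub>R q"] by simp
      qed
      then show False using p(1) \<open>s = 0\<close> ps by (simp add: zero_prod_def)
    qed
    with \<open>0 \<le> s\<close> have s: "0 < s" by simp
    have T': "b \<le> q \<bullet> w + s * (a + lam * nrm (w - y))" for w
    proof (rule field_le_epsilon)
      fix e :: real assume "0 < e"
      then show "b \<le> q \<bullet> w + s * (a + lam * nrm (w - y)) + e"
        using T[of "e / s" w] s by (simp add: algebra_simps)
    qed
    show ?thesis
    proof (rule that[of "(1 / s) *\<^sub>R q"])
      \<comment> \<open>Along the ray from \<open>y\<close> in direction \<open>v\<close> the
        right-hand side of \<open>T'\<close> is affine in the step length \<open>t\<close>. A
        negative slope would push it below \<open>b\<close> at the \<open>t\<close> chosen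
        here.\<close>
      have pos: "0 \<le> q \<bullet> v + s * (lam * nrm v)" for v
      proof (rule ccontr)
        assume "\<not> ?thesis"
        then have neg: "q \<bullet> v + s * (lam * nrm v) < 0" by simp
        define t where "t = (\<bar>b - q \<bullet> y - s * a\<bar> + 1) / - (q \<bullet> v + s * (lam * nrm v))"
        have t: "0 < t" "t * (q \<bullet> v + s * (lam * nrm v)) = - (\<bar>b - q \<bullet> y - s * a\<bar> + 1)"
          using neg by (auto simp: t_def intro!: divide_pos_pos) (simp add: field_simps)
        show False
          using T'[of "y + t *\<^sub>R v"] t
          by (simp add: is_norm_scale[OF nrm] inner_add_right algebra_simps)
      qed
      show "dual_norm nrm ((1 / s) *\<^sub>R q) \<le> lam"
      proof (rule dual_norm_le[OF nrm lam])
        fix v show "(1 / s) *\<^sub>R q \<bullet> v \<le> lam * nrm v"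
          using pos[of "- v"] s by (simp add: is_norm_minus[OF nrm] field_simps)
      qed
      fix w assume w: "w \<in> \<Xi>"
      show "u w \<le> ereal (a - (1 / s) *\<^sub>R q \<bullet> (w - y))"
      proof (cases "u w")
        case (real r)
        have "q \<bullet> w + s * r \<le> q \<bullet> y + s * a"
          using S[of r w] T'[of y] w real nrm by simp
        then show ?thesis using real s by (simp add: field_simps inner_diff_right)
      qed (use le[OF w] in auto)
    qed
  qed
qed

text \<open>Both suprema are bounded below by their terms at the same \<open>w\<close>, where
  \<open>v\<close> cancels. What remains is an affine bound on \<open>u\<close> with slope
  \<open>- z\<close>, and the dual norm inequality turns it into the norm bound.\<close>

lemma conjugate_constraint_imp_le:
  fixes nrm :: "'a::euclidean_space \<Rightarrow> real"
  assumes nrm: "is_norm nrm"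
    and con: "conjugate_on \<Xi> (\<lambda>w. - u w) (z - v) + support_fun \<Xi> v - ereal (z \<bullet> y) \<le> ereal a"
    and z: "dual_norm nrm z \<le> lam" and w: "w \<in> \<Xi>"
  shows "u w \<le> ereal (a + lam * nrm (w - y))"
proof -
  have le: "(ereal ((z - v) \<bullet> w) - - u w) + ereal (v \<bullet> w) \<le> conjugate_on \<Xi> (\<lambda>w. - u w) (z - v) + support_fun \<Xi> v"
    unfolding conjugate_on_def support_fun_def using w by (intro add_mono SUP_upper)
  have "(ereal ((z - v) \<bullet> w) - - u w) + ereal (v \<bullet> w) - ereal (z \<bullet> y) \<le> ereal a"
    by (rule order_trans[OF ereal_minus_mono[OF le order_refl] con])
  then have "u w \<le> ereal (a - z \<bullet> (w - y))"
    by (cases "u w") (auto simp: inner_diff_left inner_diff_right)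
  also have "a - z \<bullet> (w - y) \<le> a + lam * nrm (w - y)"
    using inner_le_dual_norm[OF nrm, of z "- (w - y)"] mult_right_mono[OF z is_norm_nonneg[OF nrm, of "w - y"]]
    unfolding is_norm_minus[OF nrm] inner_minus_right by linarith
  finally show ?thesis by simp
qed

lemma le_imp_conjugate_constraint:
  fixes nrm :: "'a::euclidean_space \<Rightarrow> real"
  assumes "is_norm nrm" "ereal_concave u" "convex \<Xi>" "0 \<le> lam" "y \<in> \<Xi>"
    and "\<And>w. w \<in> \<Xi> \<Longrightarrow> u w \<le> ereal (a + lam * nrm (w - y))"
  obtains z where "dual_norm nrm z \<le> lam"
    "conjugate_on \<Xi> (\<lambda>w. - u w) (z - 0) + support_fun \<Xi> 0 - ereal (z \<bullet> y) \<le> ereal a"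
proof -
  obtain z where z: "dual_norm nrm z \<le> lam" "\<And>w. w \<in> \<Xi> \<Longrightarrow> u w \<le> ereal (a - z \<bullet> (w - y))"
    using concave_norm_sandwich[OF assms(1-4,6)] by metis
  have "conjugate_on \<Xi> (\<lambda>w. - u w) z \<le> ereal (a + z \<bullet> y)"
    unfolding conjugate_on_def
  proof (rule SUP_least)
    fix w assume "w \<in> \<Xi>"
    from z(2)[OF this] show "ereal (z \<bullet> w) - - u w \<le> ereal (a + z \<bullet> y)"
      by (cases "u w") (auto simp: inner_diff_right)
  qed
  \<comment> \<open>The point \<open>y\<close> makes \<Xi> nonempty; over the empty set the supremum
    would be \<open>-\<infinity>\<close>.\<close>
  moreover have "support_fun \<Xi> 0 = 0"
    using assms(5) unfolding support_fun_def inner_zero_left zero_ereal_def[symmetric]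
    by (intro SUP_const) auto
  ultimately show ?thesis
    using z(1) by (intro that[of z]) (auto simp: ereal_minus_le_iff add.commute)
qed

section \<open>The reformulation as a finite convex program\<close>

lemma reform_feasible_iff:
  fixes nrm :: "real^'m \<Rightarrow> real" and h :: "'i::finite \<Rightarrow> real^'n \<Rightarrow> real^'m \<Rightarrow> ereal"
  shows "(x, lam, \<alpha>, z, v) \<in> reform_feasible X \<Xi> nrm data c h \<longleftrightarrow>
     (\<forall>l i. conjugate_on \<Xi> (\<lambda>w. - h i x w) (z $ l $ i - v $ l $ i)
              + support_fun \<Xi> (v $ l $ i) - ereal (z $ l $ i \<bullet> data l) \<le> ereal (\<alpha> $ l) \<and>
            dual_norm nrm (z $ l $ i) \<le> lam $ c l) \<and> x \<in> X \<and> (\<forall>k. 0 \<le> lam $ k)"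
  unfolding reform_feasible_def cluster_def by auto

lemma reform_feasible_eq_program_feasible:
  fixes nrm :: "real^'m \<Rightarrow> real" and h :: "'i::finite \<Rightarrow> real^'n \<Rightarrow> real^'m \<Rightarrow> ereal"
  shows "reform_feasible X \<Xi> nrm data c h =
    program_feasible (X \<times> UNIV) (reform_constraints \<Xi> nrm data c h)"
proof -
  \<comment> \<open>Moving a term across the inequality is an equivalence for infinite
    \<open>p\<close> too, because the moved term is real.\<close>
  have le: "p - ereal r \<le> 0 \<longleftrightarrow> p \<le> ereal r" for p r by (cases p) auto
  have ball1: "(\<forall>q\<in>{F k | k. True}. P q) \<longleftrightarrow> (\<forall>k. P (F k))" for F :: "'x \<Rightarrow> 'y" and P by blast
  have ball2: "(\<forall>q\<in>{F l i | l i. True}. P q) \<longleftrightarrow> (\<forall>l i. P (F l i))"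
    for F :: "'x \<Rightarrow> 'y \<Rightarrow> 'z" and P by blast
  have ball3: "(\<forall>q\<in>{F k l i | k l i. R k l}. P q) \<longleftrightarrow> (\<forall>k l i. R k l \<longrightarrow> P (F k l i))"
    for F :: "'x \<Rightarrow> 'y \<Rightarrow> 'z \<Rightarrow> 'w" and R P by blast
  show ?thesis
    unfolding set_eq_iff split_paired_All reform_feasible_iff program_feasible_def reform_constraints_def
      mem_Collect_eq ball_Un ball1 ball2 ball3
    by (auto simp: cluster_def le)
qed

lemma finite_convex_program_reform:
  fixes nrm :: "real^'m \<Rightarrow> real" and h :: "'i::finite \<Rightarrow> real^'n \<Rightarrow> real^'m \<Rightarrow> ereal"
    and data :: "'l::finite \<Rightarrow> real^'m" and c :: "'l \<Rightarrow> 'k::finite"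
  assumes "is_norm nrm" "convex X" "ereal_convex f" "\<And>i w. ereal_convex (\<lambda>x. h i x w)"
  shows "finite_convex_program (X \<times> UNIV)
    (reform_objective f c \<theta> :: ('n, 'm, 'k, 'l, 'i) decision \<Rightarrow> ereal)
    (reform_constraints \<Xi> nrm data c h)"
  unfolding finite_convex_program_def
proof (intro conjI ballI)
  show "convex (X \<times> (UNIV :: ((real, 'k) vec \<times> (real, 'l) vec
    \<times> (((real, 'm) vec, 'i) vec, 'l) vec \<times> (((real, 'm) vec, 'i) vec, 'l) vec) set))"
    using assms(2) by (intro convex_Times) auto
  show "ereal_convex (reform_objective f c \<theta> :: ('n, 'm, 'k, 'l, 'i) decision \<Rightarrow> ereal)"
    unfolding reform_objective_def case_prod_unfold
    by (intro ereal_convex_add ereal_convex_linear ereal_convex_compose_linear[OF linear_fst assms(3)] linearI)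
       (simp_all add: algebra_simps sum.distrib add_divide_distrib sum_distrib_left, auto intro!: sum.cong)
  show "finite (reform_constraints \<Xi> nrm data c h :: (('n, 'm, 'k, 'l, 'i) decision \<Rightarrow> ereal) set)"
  proof -
    have fin2: "finite {F l i | l i. True}" for F :: "'l \<Rightarrow> 'i \<Rightarrow> 'x"
      by (rule finite_subset[of _ "(\<lambda>(l, i). F l i) ` UNIV"]) force+
    have fin3: "finite {F k l i | k l i. R k l}" for F :: "'k \<Rightarrow> 'l \<Rightarrow> 'i \<Rightarrow> 'x" and R
    proof -
      have "F k l i \<in> range (\<lambda>(k, l, i). F k l i)" for k l i by (rule image_eqI[of _ _ "(k, l, i)"]) auto
      then have "{F k l i | k l i. R k l} \<subseteq> range (\<lambda>(k, l, i). F k l i)" by blast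
      then show ?thesis by (rule finite_subset) simp
    qed
    have fin1: "finite {F k | k. True}" for F :: "'k \<Rightarrow> 'x" by (simp add: full_SetCompr_eq)
    show ?thesis
      unfolding reform_constraints_def by (intro finite_UnI fin1 fin2 fin3)
  qed
  fix q :: "('n, 'm, 'k, 'l, 'i) decision \<Rightarrow> ereal"
  assume "q \<in> reform_constraints \<Xi> nrm data c h"
  then consider
      (conj) l i where "q = (\<lambda>(x, lam, \<alpha>, z, v). conjugate_on \<Xi> (\<lambda>w. - h i x w) (z $ l $ i - v $ l $ i)
          + support_fun \<Xi> (v $ l $ i) - ereal (z $ l $ i \<bullet> data l) - ereal (\<alpha> $ l))"
    | (dual) k l i where "q = (\<lambda>(x, lam, \<alpha>, z, v). ereal (dual_norm nrm (z $ l $ i) - lam $ k))"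
    | (nonneg) k where "q = (\<lambda>(x, lam, \<alpha>, z, v). ereal (- lam $ k))"
    unfolding reform_constraints_def by auto
  then show "ereal_convex q"
  proof cases
    case conj
    \<comment> \<open>The constraint is written as a sum of convex functions of linear images of the
      decision, the form to which the closure lemmas apply.\<close>
    have q: "q = (\<lambda>d. (\<lambda>(x, z). conjugate_on \<Xi> (\<lambda>w. - h i x w) z)
          ((\<lambda>(x, lam, \<alpha>, z, v). (x, z $ l $ i - v $ l $ i)) d)
        + support_fun \<Xi> ((\<lambda>(x, lam, \<alpha>, z, v). v $ l $ i) d)
        + ereal ((\<lambda>(x, lam, \<alpha>, z, v). - (z $ l $ i \<bullet> data l)) d)
        + ereal ((\<lambda>(x, lam, \<alpha>, z, v). - \<alpha> $ l) d))"
      by (auto simp: conj fun_eq_iff minus_ereal_def)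
    show ?thesis
      unfolding q
      by (intro ereal_convex_add ereal_convex_linear ereal_convex_conjugate_on assms(4)
          ereal_convex_compose_linear[where u = "\<lambda>(x, z). conjugate_on \<Xi> (\<lambda>w. - h i x w) z"]
          ereal_convex_compose_linear[OF _ ereal_convex_support_fun] linearI)
         (auto simp: algebra_simps inner_add_left)
  next
    case dual
    have q: "q = (\<lambda>d. ereal (dual_norm nrm ((\<lambda>(x, lam, \<alpha>, z, v). z $ l $ i) d))
        + ereal ((\<lambda>(x, lam, \<alpha>, z, v). - lam $ k) d))"
      by (auto simp: dual fun_eq_iff)
    show ?thesis
      unfolding q
      by (intro ereal_convex_add ereal_convex_linear
          ereal_convex_compose_linear[OF _ ereal_convex_dual_norm[OF assms(1)]] linearI) auto
  next
    case nonneg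
    show ?thesis
      unfolding nonneg case_prod_unfold by (intro ereal_convex_linear linearI) auto
  qed
qed

subsection \<open>Expectations of extended-real functions\<close>

lemma nn_integral_mixture:
  fixes Q :: "'j \<Rightarrow> 'a::topological_space measure"
  assumes J: "finite J" and Q: "\<And>j. j \<in> J \<Longrightarrow> sets (Q j) = sets borel"
    and f: "f \<in> borel_measurable borel"
  shows "(\<integral>\<^sup>+ x. f x \<partial>mixture J p Q) = (\<Sum>j\<in>J. ennreal (p j) * (\<integral>\<^sup>+ x. f x \<partial>Q j))"
  using f
proof (induction rule: borel_measurable_induct)
  case (cong f g)
  then show ?case by (simp add: fun_eq_iff[symmetric] cong: nn_integral_cong)
next
  case (set A)
  then show ?case by (simp add: emeasure_mixture[OF J Q] Q)
next
  case (mult u a)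
  have "u \<in> borel_measurable (Q j)" if "j \<in> J" for j
    using mult.hyps Q[OF that] by (simp cong: measurable_cong_sets)
  with mult show ?case
    by (simp add: nn_integral_cmult sum_distrib_left mult_ac cong: measurable_cong_sets)
next
  case (add u v)
  have "u \<in> borel_measurable (Q j)" "v \<in> borel_measurable (Q j)" if "j \<in> J" for j
    using add.hyps Q[OF that] by (simp_all cong: measurable_cong_sets)
  with add show ?case
    by (simp add: nn_integral_add sum.distrib distrib_left cong: measurable_cong_sets)
next
  case (seq U)
  have meas: "U i \<in> borel_measurable (Q j)" if "j \<in> J" for i j
    using seq.hyps Q[OF that] by (simp cong: measurable_cong_sets)
  have "(\<integral>\<^sup>+ x. (SUP i. U i) x \<partial>mixture J p Q) = (SUP i. \<integral>\<^sup>+ x. U i x \<partial>mixture J p Q)"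
    unfolding SUP_apply using seq.hyps
    by (intro nn_integral_monotone_convergence_SUP) (auto cong: measurable_cong_sets)
  also have "\<dots> = (SUP i. \<Sum>j\<in>J. ennreal (p j) * (\<integral>\<^sup>+ x. U i x \<partial>Q j))"
    using seq.IH by simp
  also have "\<dots> = (\<Sum>j\<in>J. SUP i. ennreal (p j) * (\<integral>\<^sup>+ x. U i x \<partial>Q j))"
    using seq.hyps
    by (intro ennreal_SUP_sum)
       (auto simp: incseq_def le_fun_def intro!: mult_left_mono nn_integral_mono)
  also have "\<dots> = (\<Sum>j\<in>J. ennreal (p j) * (\<integral>\<^sup>+ x. (SUP i. U i) x \<partial>Q j))"
    unfolding SUP_apply using seq.hyps
    by (intro sum.cong refl)
       (simp add: nn_integral_monotone_convergence_SUP meas SUP_mult_left_ennreal)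
  finally show ?case .
qed

text \<open>As the image of the uniform distribution on indices, the empirical measure has finite
  sums as integrals, and couplings with it can be built on indices, where coinciding data points
  remain distinct.\<close>

lemma empirical_eq_distr:
  fixes data :: "'l::finite \<Rightarrow> 'a::topological_space"
  assumes "cluster c k \<noteq> {}"
  shows "empirical data c k = distr (measure_pmf (pmf_of_set (cluster c k))) borel data"
proof (rule measure_eqI)
  fix A assume "A \<in> sets (empirical data c k)"
  then have A: "A \<in> sets borel" by (simp add: empirical_def)
  let ?C = "cluster c k"
  have "emeasure (empirical data c k) A = (\<Sum>l\<in>?C. ennreal (1 / real (card ?C)) * indicator A (data l))"
    unfolding empirical_def using A by (simp add: emeasure_mixture)
  also have "\<dots> = (\<integral>\<^sup>+ l. indicator A (data l) \<partial>measure_pmf (pmf_of_set ?C))"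
    using assms by (subst nn_integral_measure_pmf_finite) (auto simp: mult.commute)
  also have "\<dots> = (\<integral>\<^sup>+ w. indicator A w \<partial>distr (measure_pmf (pmf_of_set ?C)) borel data)"
    using A by (intro nn_integral_distr[symmetric]) auto
  also have "\<dots> = emeasure (distr (measure_pmf (pmf_of_set ?C)) borel data) A"
    using A by simp
  finally show "emeasure (empirical data c k) A = emeasure (distr (measure_pmf (pmf_of_set ?C)) borel data) A" .
qed (simp add: empirical_def)

lemma ereal_expectation_mixture:
  fixes Q :: "'j \<Rightarrow> 'a::topological_space measure"
  assumes J: "finite J" and Q: "\<And>j. j \<in> J \<Longrightarrow> sets (Q j) = sets borel"
    and p: "\<And>j. j \<in> J \<Longrightarrow> 0 \<le> p j" and u: "u \<in> borel_measurable borel"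
    and fin: "\<And>j. j \<in> J \<Longrightarrow> (\<integral>\<^sup>+ w. e2ennreal (u w) \<partial>Q j) < \<infinity>"
  shows "ereal_expectation (mixture J p Q) u = (\<Sum>j\<in>J. ereal (p j) * ereal_expectation (Q j) u)"
proof -
  \<comment> \<open>The second conjunct carries finiteness of the positive part through the
    induction. Only negative parts may then be infinite, and the difference distributes over the
    sum.\<close>
  have "enn2ereal (\<Sum>j\<in>J. ennreal (p j) * a j) - enn2ereal (\<Sum>j\<in>J. ennreal (p j) * b j) =
      (\<Sum>j\<in>J. ereal (p j) * (enn2ereal (a j) - enn2ereal (b j))) \<and>
      (\<Sum>j\<in>J. ennreal (p j) * a j) < \<infinity>"
    if "\<And>j. j \<in> J \<Longrightarrow> a j < \<infinity>" for a b
    using J p that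
  proof (induction J rule: finite_induct)
    case (insert j J)
    obtain r where r: "a j = ennreal r" "0 \<le> r" using insert.prems(2)[of j] by (cases "a j") auto
    obtain s where s: "(\<Sum>j\<in>J. ennreal (p j) * a j) = ennreal s" "0 \<le> s"
      using insert by (cases "\<Sum>j\<in>J. ennreal (p j) * a j") auto
    have IH: "enn2ereal (\<Sum>j\<in>J. ennreal (p j) * a j) - enn2ereal (\<Sum>j\<in>J. ennreal (p j) * b j) =
      (\<Sum>j\<in>J. ereal (p j) * (enn2ereal (a j) - enn2ereal (b j)))"
      using insert by auto
    have pj: "0 \<le> p j" using insert by auto
    have aux: "(ereal (p j) * ereal r + ereal s) - (ereal (p j) * B + D)
        = ereal (p j) * (ereal r - B) + (ereal s - D)" if "0 \<le> B" "0 \<le> D" for B D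
      using that pj by (cases B; cases D; cases "p j = 0") (auto simp: algebra_simps)
    have "(\<Sum>j\<in>insert j J. ennreal (p j) * a j) < \<infinity>"
      unfolding sum.insert[OF insert.hyps] s r using s r by (simp add: ennreal_mult_less_top)
    moreover have "enn2ereal (\<Sum>j\<in>insert j J. ennreal (p j) * a j) - enn2ereal (\<Sum>j\<in>insert j J. ennreal (p j) * b j)
        = (\<Sum>j\<in>insert j J. ereal (p j) * (enn2ereal (a j) - enn2ereal (b j)))"
      unfolding sum.insert[OF insert.hyps] IH[symmetric] plus_ennreal.rep_eq times_ennreal.rep_eq s(1) r(1)
        enn2ereal_ennreal[OF pj] enn2ereal_ennreal[OF s(2)] enn2ereal_ennreal[OF r(2)]
      by (rule aux) simp_all
    ultimately show ?case by blast
  qed (simp add: zero_ennreal.rep_eq)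
  moreover have "(\<lambda>w. e2ennreal (u w)) \<in> borel_measurable borel" "(\<lambda>w. e2ennreal (- u w)) \<in> borel_measurable borel"
    using u by measurable
  ultimately show ?thesis
    unfolding ereal_expectation_def using fin by (simp add: nn_integral_mixture[OF J Q])
qed

lemma ereal_expectation_distr:
  assumes "f \<in> measurable M N" "u \<in> borel_measurable N"
  shows "ereal_expectation (distr M N f) u = ereal_expectation M (\<lambda>x. u (f x))"
  unfolding ereal_expectation_def using assms by (simp add: nn_integral_distr)

lemma ereal_expectation_eq_integral:
  fixes B :: "'a \<Rightarrow> real"
  assumes "integrable M B" "AE x in M. u x = ereal (B x)"
  shows "ereal_expectation M u = ereal (\<integral>x. B x \<partial>M)"
proof -
  have 1: "(\<integral>\<^sup>+ x. e2ennreal (u x) \<partial>M) = (\<integral>\<^sup>+ x. ennreal (B x) \<partial>M)"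
    using assms(2) by (intro nn_integral_cong_AE) auto
  have 2: "(\<integral>\<^sup>+ x. e2ennreal (- u x) \<partial>M) = (\<integral>\<^sup>+ x. ennreal (- B x) \<partial>M)"
    using assms(2) by (intro nn_integral_cong_AE) auto
  have "(\<integral>\<^sup>+ x. ennreal (B x) \<partial>M) < \<infinity>" "(\<integral>\<^sup>+ x. ennreal (- B x) \<partial>M) < \<infinity>"
    using assms(1) by (auto simp: real_integrable_def less_top)
  then show ?thesis
    unfolding ereal_expectation_def 1 2 real_lebesgue_integral_def[OF assms(1)]
    by (cases "\<integral>\<^sup>+ x. ennreal (B x) \<partial>M"; cases "\<integral>\<^sup>+ x. ennreal (- B x) \<partial>M")
       (auto simp: enn2ereal_ennreal)
qed

lemma ereal_expectation_le_integral:
  fixes B :: "'a \<Rightarrow> real"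
  assumes B: "integrable M B" and u: "u \<in> borel_measurable M" and le: "AE x in M. u x \<le> ereal (B x)"
  shows "(\<integral>\<^sup>+ x. e2ennreal (u x) \<partial>M) < \<infinity>" "ereal_expectation M u \<le> ereal (\<integral>x. B x \<partial>M)"
proof -
  note [measurable] = u borel_measurable_integrable[OF B]
  have fin: "(\<integral>\<^sup>+ x. ennreal (B x) \<partial>M) < \<infinity>" "(\<integral>\<^sup>+ x. ennreal (- B x) \<partial>M) < \<infinity>"
    using B by (auto simp: real_integrable_def less_top)
  have "(\<integral>\<^sup>+ x. e2ennreal (u x) \<partial>M) \<le> (\<integral>\<^sup>+ x. ennreal (B x) \<partial>M)"
    using le by (intro nn_integral_mono_AE) (auto simp flip: e2ennreal_ereal intro!: e2ennreal_mono)
  with fin show pos: "(\<integral>\<^sup>+ x. e2ennreal (u x) \<partial>M) < \<infinity>" by (auto intro: le_less_trans)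
  \<comment> \<open>The comparison of \<open>v\<close> with \<open>b\<close> is rearranged into sums
    of positive and negative parts, which can be integrated without any subtraction.\<close>
  have "e2ennreal v + ennreal (- b) \<le> e2ennreal (- v) + ennreal b" if "v \<le> ereal b" for v b
  proof (cases v)
    case (real r)
    then have "r \<le> b" using that by simp
    then have "max 0 r + max 0 (- b) \<le> max 0 (- r) + max 0 b" by (auto simp: max_def)
    then have "ennreal (max 0 r + max 0 (- b)) \<le> ennreal (max 0 (- r) + max 0 b)" by (rule ennreal_leI)
    then show ?thesis using real by (simp add: ennreal_max_0')
  qed (use that in \<open>auto simp: e2ennreal_neg\<close>)
  then have "(\<integral>\<^sup>+ x. e2ennreal (u x) + ennreal (- B x) \<partial>M) \<le> (\<integral>\<^sup>+ x. e2ennreal (- u x) + ennreal (B x) \<partial>M)"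
    using le by (intro nn_integral_mono_AE) auto
  then have "(\<integral>\<^sup>+ x. e2ennreal (u x) \<partial>M) + (\<integral>\<^sup>+ x. ennreal (- B x) \<partial>M)
      \<le> (\<integral>\<^sup>+ x. e2ennreal (- u x) \<partial>M) + (\<integral>\<^sup>+ x. ennreal (B x) \<partial>M)"
    by (simp add: nn_integral_add)
  with fin pos show "ereal_expectation M u \<le> ereal (\<integral>x. B x \<partial>M)"
    unfolding ereal_expectation_def real_lebesgue_integral_def[OF B]
    by (cases "\<integral>\<^sup>+ x. ennreal (B x) \<partial>M"; cases "\<integral>\<^sup>+ x. ennreal (- B x) \<partial>M";
        cases "\<integral>\<^sup>+ x. e2ennreal (u x) \<partial>M"; cases "\<integral>\<^sup>+ x. e2ennreal (- u x) \<partial>M")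
       (auto simp: enn2ereal_ennreal ennreal_plus[symmetric] simp del: ennreal_plus)
qed

subsection \<open>Duality over Wasserstein balls\<close>

lemma wasserstein_weak_duality:
  fixes nrm :: "'a::euclidean_space \<Rightarrow> real" and data :: "'l::finite \<Rightarrow> 'a" and c :: "'l \<Rightarrow> 'k" and k :: 'k
  defines "C \<equiv> cluster c k"
  assumes nrm: "is_norm nrm" and ne: "C \<noteq> {}"
    and Q: "Q \<in> wasserstein_ball nrm \<Xi> (empirical data c k) \<theta>" and \<theta>: "0 \<le> \<theta>"
    and u: "u \<in> borel_measurable borel" and lam: "0 \<le> lam"
    and le: "\<And>l w. l \<in> C \<Longrightarrow> w \<in> \<Xi> \<Longrightarrow> u w \<le> ereal (\<alpha> l + lam * nrm (w - data l))"
  shows "(\<integral>\<^sup>+ w. e2ennreal (u w) \<partial>Q) < \<infinity>"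
    and "ereal_expectation Q u \<le> ereal (lam * \<theta> + (\<Sum>l\<in>C. \<alpha> l) / real (card (C)))"
proof -
  let ?P = "empirical data c k"
  have P: "?P = distr (measure_pmf (pmf_of_set C)) borel data"
    using empirical_eq_distr[OF ne[unfolded C_def]] unfolding C_def .
  \<comment> \<open>If several data points coincide, the coupling only sees the smallest of their values \<open>\<alpha>\<close>.\<close>
  define b where "b y = (if y \<in> data ` C then Min (\<alpha> ` {l \<in> C. data l = y}) else 0)" for y
  have b_le: "b (data l) \<le> \<alpha> l" if "l \<in> C" for l
    using that by (auto simp: b_def intro!: Min_le)
  have le_b: "u w \<le> ereal (b y + lam * nrm (w - y))" if w: "w \<in> \<Xi>" and y: "y \<in> data ` C" for w y
  proof -
    have "Min (\<alpha> ` {l \<in> C. data l = y}) \<in> \<alpha> ` {l \<in> C. data l = y}"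
      using y by (intro Min_in) auto
    then obtain l where "l \<in> C" "data l = y" "b y = \<alpha> l" using y by (auto simp: b_def)
    then show ?thesis using le[of l w] w by simp
  qed
  \<comment> \<open>A finite combination of indicators of points is Borel measurable.\<close>
  have b_eq: "b = (\<lambda>y. \<Sum>v\<in>data ` C. b v * indicator {v} y)"
  proof
    fix y
    have "(\<Sum>v\<in>data ` C. b v * indicator {v} y) = (\<Sum>v\<in>data ` C. if v = y then b y else 0)"
      by (intro sum.cong) (auto simp: indicator_def)
    then show "b y = (\<Sum>v\<in>data ` C. b v * indicator {v} y)"
      by (simp add: sum.delta b_def)
  qed
  have [measurable]: "b \<in> borel_measurable borel"
    by (subst b_eq) measurable
  have [measurable]: "nrm \<in> borel_measurable borel"
    by (intro borel_measurable_continuous_onI is_norm_continuous_on nrm)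
  have int_b: "integrable ?P b" unfolding P
    by (subst integrable_distr_eq) (auto intro!: integrable_measure_pmf_finite simp: ne)
  have "(\<integral>y. b y \<partial>?P) = (\<Sum>l\<in>C. b (data l)) / real (card C)" unfolding P
    by (subst integral_distr) (auto simp: integral_pmf_of_set ne)
  also have "\<dots> \<le> (\<Sum>l\<in>C. \<alpha> l) / real (card C)"
    by (intro divide_right_mono sum_mono b_le) auto
  finally have b_int_le: "(\<integral>y. b y \<partial>?P) \<le> (\<Sum>l\<in>C. \<alpha> l) / real (card C)" .
  \<comment> \<open>The infimum over couplings is not known to be attained, so a coupling of cost
    below \<open>\<theta> + e\<close> is used.\<close>
  have main: "(\<integral>\<^sup>+ w. e2ennreal (u w) \<partial>Q) < \<infinity> \<and>
      ereal_expectation Q u \<le> ereal (lam * (\<theta> + e) + (\<Sum>l\<in>C. \<alpha> l) / real (card C))" if e: "0 < e" for e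
  proof -
    have "wasserstein nrm \<Xi> Q ?P < ennreal (\<theta> + e)"
      using Q \<theta> e unfolding wasserstein_ball_def by (auto intro: le_less_trans simp: ennreal_less_iff)
    then obtain \<pi> where \<pi>: "\<pi> \<in> couplings \<Xi> Q ?P"
      and cost: "(\<integral>\<^sup>+ (x, y). ennreal (nrm (x - y)) \<partial>\<pi>) < ennreal (\<theta> + e)"
      unfolding wasserstein_def INF_less_iff by blast
    have sets_\<pi> [measurable_cong]: "sets \<pi> = sets (borel \<Otimes>\<^sub>M borel)" and "prob_space \<pi>"
      and mass: "emeasure \<pi> (\<Xi> \<times> \<Xi>) = 1"
      and fst: "distr \<pi> borel fst = Q" and snd: "distr \<pi> borel snd = ?P"
      using \<pi> unfolding couplings_def prob_measures_on_def borel_prod by blast+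
    interpret prob_space \<pi> by fact
    define B where "B = (\<lambda>(w, y). b y + lam * nrm (w - y))"
    have nrm_int: "integrable \<pi> (\<lambda>x. nrm (fst x - snd x))"
      using cost by (intro integrableI_bounded)
        (auto simp: case_prod_unfold is_norm_nonneg[OF nrm] less_top intro: less_trans)
    have b_int: "integrable \<pi> (\<lambda>x. b (snd x))"
      using int_b unfolding snd[symmetric] by (subst (asm) integrable_distr_eq) auto
    have B_int: "integrable \<pi> B"
      unfolding B_def case_prod_unfold by (intro Bochner_Integration.integrable_add integrable_mult_right b_int nrm_int)
    have nrm_int_le: "(\<integral>x. nrm (fst x - snd x) \<partial>\<pi>) \<le> \<theta> + e"
    proof -
      have "ennreal (\<integral>x. nrm (fst x - snd x) \<partial>\<pi>) = (\<integral>\<^sup>+ x. ennreal (nrm (fst x - snd x)) \<partial>\<pi>)"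
        using nrm_int by (intro nn_integral_eq_integral[symmetric]) (auto simp: is_norm_nonneg[OF nrm])
      then have "ennreal (\<integral>x. nrm (fst x - snd x) \<partial>\<pi>) < ennreal (\<theta> + e)"
        using cost by (simp only: case_prod_unfold)
      moreover have "0 \<le> (\<integral>x. nrm (fst x - snd x) \<partial>\<pi>)"
        by (simp add: is_norm_nonneg[OF nrm])
      ultimately show ?thesis by (simp only: ennreal_less_iff)
    qed
    have "(\<integral>x. b (snd x) \<partial>\<pi>) = (\<integral>y. b y \<partial>?P)"
      unfolding snd[symmetric] by (subst integral_distr) auto
    then have B_int_le: "(\<integral>x. B x \<partial>\<pi>) \<le> lam * (\<theta> + e) + (\<Sum>l\<in>C. \<alpha> l) / real (card C)"
      using b_int_le mult_left_mono[OF nrm_int_le lam] b_int nrm_int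
      by (simp add: B_def case_prod_unfold)
    have AE_le: "AE x in \<pi>. u (fst x) \<le> ereal (B x)"
    proof -
      \<comment> \<open>Sets outside the sigma-algebra have measure 0 by definition, so mass 1
        implies measurability.\<close>
      have "\<Xi> \<times> \<Xi> \<in> events" using mass emeasure_notin_sets by force
      then have "AE x in \<pi>. x \<in> \<Xi> \<times> \<Xi>" using mass by (simp add: AE_in_set_eq_1 measure_def)
      moreover have "AE x in \<pi>. snd x \<in> data ` C"
      proof -
        have [measurable]: "data ` C \<in> sets borel" by (intro borel_closed finite_imp_closed) simp
        have "AE y in ?P. y \<in> data ` C"
          unfolding P by (subst AE_distr_iff) (auto simp: AE_measure_pmf_iff ne)
        then show ?thesis
          unfolding snd[symmetric] by (subst (asm) AE_distr_iff) auto
      qed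
      ultimately show ?thesis
      proof eventually_elim
        case (elim x)
        then show ?case using le_b[of "fst x" "snd x"] by (auto simp: B_def case_prod_unfold)
      qed
    qed
    have meas: "(\<lambda>x. u (fst x)) \<in> borel_measurable \<pi>" using u by measurable
    note bound = ereal_expectation_le_integral[OF B_int meas AE_le]
    have "ereal_expectation \<pi> (\<lambda>x. u (fst x)) \<le> ereal (lam * (\<theta> + e) + (\<Sum>l\<in>C. \<alpha> l) / real (card C))"
      using bound(2) B_int_le by (meson ereal_less_eq(3) order_trans)
    moreover have "ereal_expectation Q u = ereal_expectation \<pi> (\<lambda>x. u (fst x))"
      unfolding fst[symmetric] using u by (intro ereal_expectation_distr) auto
    moreover have "(\<integral>\<^sup>+ w. e2ennreal (u w) \<partial>Q) = (\<integral>\<^sup>+ x. e2ennreal (u (fst x)) \<partial>\<pi>)"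
      unfolding fst[symmetric] using u by (subst nn_integral_distr) auto
    ultimately show ?thesis using bound(1) by simp
  qed
  show "(\<integral>\<^sup>+ w. e2ennreal (u w) \<partial>Q) < \<infinity>" using main[of 1] by simp
  show "ereal_expectation Q u \<le> ereal (lam * \<theta> + (\<Sum>l\<in>C. \<alpha> l) / real (card C))"
  proof (rule ereal_le_epsilon2)
    fix e :: real assume "0 < e"
    \<comment> \<open>The denominator \<open>lam + 1\<close> allows \<open>lam = 0\<close>.\<close>
    have "lam * (e / (lam + 1)) \<le> e" using lam \<open>0 < e\<close> by (simp add: field_simps)
    then have "lam * (\<theta> + e / (lam + 1)) + (\<Sum>l\<in>C. \<alpha> l) / real (card C) \<le>
        lam * \<theta> + (\<Sum>l\<in>C. \<alpha> l) / real (card C) + e"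
      by (simp add: distrib_left)
    then show "ereal_expectation Q u \<le> ereal (lam * \<theta> + (\<Sum>l\<in>C. \<alpha> l) / real (card C)) + ereal e"
      using main[of "e / (lam + 1)"] lam \<open>0 < e\<close>
      by (auto intro: order_trans)
  qed
qed

text \<open>Convex combinations arise by randomising: draw an assignment \<open>s\<close> with the
  weights \<open>m\<close>, draw an index \<open>l\<close> of the cluster uniformly and
  independently, and move \<open>data l\<close> to \<open>w s l\<close>. The law of the target is
  \<open>Q\<close>, and the joint law of target and origin is a coupling of cost
  \<open>t\<close>.\<close>

lemma hull_realised_in_wasserstein_ball:
  fixes nrm :: "'a::euclidean_space \<Rightarrow> real" and data :: "'l::finite \<Rightarrow> 'a" and c :: "'l \<Rightarrow> 'k" and k :: 'k
  defines "C \<equiv> cluster c k"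
  assumes nrm: "is_norm nrm" and ne: "C \<noteq> {}" and \<Xi>: "closed \<Xi>" and data: "\<And>l. data l \<in> \<Xi>"
    and u: "u \<in> borel_measurable borel" and u_fin: "\<And>w. u w < \<infinity>"
    and tr: "(t, r) \<in> convex hull
      {((\<Sum>l\<in>C. nrm (w l - data l)) / card (C), (\<Sum>l\<in>C. real_of_ereal (u (w l))) / card (C)) | w.
         \<forall>l\<in>C. w l \<in> \<Xi> \<and> u (w l) \<noteq> - \<infinity>}" (is "_ \<in> convex hull ?A")
    and t: "t \<le> \<theta>"
  obtains Q where "Q \<in> wasserstein_ball nrm \<Xi> (empirical data c k) \<theta>" "ereal_expectation Q u = ereal r"
proof -
  have P: "empirical data c k = distr (measure_pmf (pmf_of_set C)) borel data"
    using empirical_eq_distr[OF ne[unfolded C_def]] unfolding C_def .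
  obtain S m where S: "finite S" "S \<subseteq> ?A" "\<And>x. x \<in> S \<Longrightarrow> 0 \<le> m x" "sum m S = 1"
      "(\<Sum>v\<in>S. m v *\<^sub>R v) = (t, r)"
    using tr unfolding convex_hull_explicit by blast
  have "\<forall>s\<in>S. \<exists>w. s = ((\<Sum>l\<in>C. nrm (w l - data l)) / card C, (\<Sum>l\<in>C. real_of_ereal (u (w l))) / card C) \<and>
      (\<forall>l\<in>C. w l \<in> \<Xi> \<and> u (w l) \<noteq> - \<infinity>)"
    using S(2) by blast
  from bchoice[OF this] obtain w where
    "\<forall>s\<in>S. s = ((\<Sum>l\<in>C. nrm (w s l - data l)) / card C, (\<Sum>l\<in>C. real_of_ereal (u (w s l))) / card C) \<and>
      (\<forall>l\<in>C. w s l \<in> \<Xi> \<and> u (w s l) \<noteq> - \<infinity>)"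
    by blast
  then have
    w_eq: "\<And>s. s \<in> S \<Longrightarrow> s = ((\<Sum>l\<in>C. nrm (w s l - data l)) / card C, (\<Sum>l\<in>C. real_of_ereal (u (w s l))) / card C)"
    and w: "\<And>s l. s \<in> S \<Longrightarrow> l \<in> C \<Longrightarrow> w s l \<in> \<Xi> \<and> u (w s l) \<noteq> - \<infinity>"
    by blast+
  define q where "q = embed_pmf (\<lambda>s. if s \<in> S then m s else 0)"
  have pmf_q: "pmf q s = (if s \<in> S then m s else 0)" for s
    unfolding q_def
  proof (rule pmf_embed_pmf)
    have "(\<integral>\<^sup>+ x. ennreal (if x \<in> S then m x else 0) \<partial>count_space UNIV) = (\<Sum>x\<in>S. ennreal (m x))"
      by (subst nn_integral_count_space'[OF S(1)]) auto
    also have "\<dots> = 1" using S by (subst sum_ennreal) auto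
    finally show "(\<integral>\<^sup>+ x. ennreal (if x \<in> S then m x else 0) \<partial>count_space UNIV) = 1" .
  qed (use S in auto)
  define p where "p = pair_pmf q (pmf_of_set C)"
  have "set_pmf q \<subseteq> S" by (auto simp: set_pmf_eq pmf_q split: if_splits)
  then have set_p: "set_pmf p \<subseteq> S \<times> C" by (auto simp: p_def ne)
  then have fin_p: "finite (set_pmf p)" using S(1) by (auto intro: finite_subset)
  have int_p: "(\<integral>x. F x \<partial>measure_pmf p) = (\<Sum>s\<in>S. m s * ((\<Sum>l\<in>C. F (s, l)) / card C))" for F :: "_ \<Rightarrow> real"
  proof -
    have "(\<integral>x. F x \<partial>measure_pmf p) = (\<Sum>x\<in>S \<times> C. F x * pmf p x)"
      using S(1) set_p by (intro integral_measure_pmf_real) auto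
    also have "\<dots> = (\<Sum>s\<in>S. \<Sum>l\<in>C. m s * (F (s, l) / card C))"
      unfolding sum.cartesian_product
      by (intro sum.cong refl) (auto simp: p_def pmf_pair pmf_q ne)
    finally show ?thesis by (simp add: sum_distrib_left sum_divide_distrib)
  qed
  define W where "W = (\<lambda>(s, l). w s l)"
  have W: "W x \<in> \<Xi> \<and> u (W x) \<noteq> - \<infinity>" if "x \<in> set_pmf p" for x
    using that set_p w by (auto simp: W_def)
  define Q where "Q = distr (measure_pmf p) borel W"
  define \<pi> where "\<pi> = distr (measure_pmf p) borel (\<lambda>x. (W x, data (snd x)))"
  have fst_meas: "fst \<in> measurable (borel :: ('a \<times> 'a) measure) borel"
    by (intro borel_measurable_continuous_onI continuous_on_fst continuous_on_id)
  have snd_meas: "snd \<in> measurable (borel :: ('a \<times> 'a) measure) borel"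
    by (intro borel_measurable_continuous_onI continuous_on_snd continuous_on_id)
  have Q_prob: "Q \<in> prob_measures_on \<Xi>"
    unfolding prob_measures_on_def
  proof safe
    show "prob_space Q" unfolding Q_def by (intro measure_pmf.prob_space_distr) simp
    have "emeasure Q \<Xi> = emeasure (measure_pmf p) (W -` \<Xi>)"
      unfolding Q_def using \<Xi> by (subst emeasure_distr) auto
    also have "\<dots> = 1" using W by (auto simp: measure_pmf.emeasure_eq_1_AE AE_measure_pmf_iff)
    finally show "emeasure Q \<Xi> = 1" .
  qed (simp_all add: Q_def)
  have "\<pi> \<in> couplings \<Xi> Q (empirical data c k)"
    unfolding couplings_def prob_measures_on_def
  proof safe
    show "prob_space \<pi>" unfolding \<pi>_def by (intro measure_pmf.prob_space_distr) simp
    have "emeasure \<pi> (\<Xi> \<times> \<Xi>) = emeasure (measure_pmf p) ((\<lambda>x. (W x, data (snd x))) -` (\<Xi> \<times> \<Xi>))"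
      unfolding \<pi>_def using \<Xi> by (subst emeasure_distr) (auto intro!: borel_closed closed_Times)
    also have "\<dots> = 1" using W data by (auto simp: measure_pmf.emeasure_eq_1_AE AE_measure_pmf_iff)
    finally show "emeasure \<pi> (\<Xi> \<times> \<Xi>) = 1" .
    show "distr \<pi> borel fst = Q"
      unfolding \<pi>_def Q_def by (subst distr_distr[OF fst_meas]) (auto simp: comp_def)
    \<comment> \<open>Since \<open>s\<close> and \<open>l\<close> are independent, forgetting
      \<open>s\<close> leaves \<open>l\<close> uniform on the cluster.\<close>
    have "distr \<pi> borel snd = distr (measure_pmf p) borel (data \<circ> snd)"
      unfolding \<pi>_def by (subst distr_distr[OF snd_meas]) (auto simp: comp_def)
    also have "\<dots> = distr (distr (measure_pmf p) (count_space UNIV) snd) borel data"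
      by (subst distr_distr) auto
    also have "distr (measure_pmf p) (count_space UNIV) snd = measure_pmf (pmf_of_set C)"
      unfolding map_pmf_rep_eq[symmetric] by (simp add: p_def map_snd_pair_pmf)
    finally show "distr \<pi> borel snd = empirical data c k" unfolding P .
  qed (simp_all add: \<pi>_def)
  then have "wasserstein nrm \<Xi> Q (empirical data c k) \<le> (\<integral>\<^sup>+ (x, y). ennreal (nrm (x - y)) \<partial>\<pi>)"
    unfolding wasserstein_def by (rule INF_lower)
  also have "(\<integral>\<^sup>+ (x, y). ennreal (nrm (x - y)) \<partial>\<pi>) = (\<integral>\<^sup>+ x. ennreal (nrm (W x - data (snd x))) \<partial>measure_pmf p)"
  proof -
    have "continuous_on UNIV (\<lambda>z. nrm (fst z - snd z))"
      by (rule continuous_on_compose2[OF is_norm_continuous_on[OF nrm, of UNIV]]) (auto intro!: continuous_intros)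
    then have "(\<lambda>z. ennreal (nrm (fst z - snd z))) \<in> borel_measurable borel"
      by (intro measurable_compose[OF borel_measurable_continuous_onI measurable_ennreal])
    then show ?thesis
      unfolding \<pi>_def case_prod_unfold by (subst nn_integral_distr) auto
  qed
  also have "\<dots> = ennreal (\<integral>x. nrm (W x - data (snd x)) \<partial>measure_pmf p)"
    by (intro nn_integral_eq_integral integrable_measure_pmf_finite fin_p) (simp add: is_norm_nonneg[OF nrm])
  also have "(\<integral>x. nrm (W x - data (snd x)) \<partial>measure_pmf p) = (\<Sum>s\<in>S. m s * fst s)"
    unfolding int_p by (intro sum.cong refl) (subst (3) w_eq, auto simp: W_def)
  also have "\<dots> = t" using arg_cong[OF S(5), of fst] by (simp add: fst_sum)
  also have "ennreal t \<le> ennreal \<theta>" by (rule ennreal_leI[OF t])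
  finally have "wasserstein nrm \<Xi> Q (empirical data c k) \<le> ennreal \<theta>" .
  moreover have "ereal_expectation Q u = ereal r"
  proof -
    have "ereal_expectation Q u = ereal_expectation (measure_pmf p) (\<lambda>x. u (W x))"
      unfolding Q_def using u by (intro ereal_expectation_distr) auto
    also have "\<dots> = ereal (\<integral>x. real_of_ereal (u (W x)) \<partial>measure_pmf p)"
    proof (intro ereal_expectation_eq_integral integrable_measure_pmf_finite fin_p AE_pmfI)
      fix x assume "x \<in> set_pmf p"
      then show "u (W x) = ereal (real_of_ereal (u (W x)))"
        using W[of x] u_fin[of "W x"] by (cases "u (W x)") auto
    qed
    also have "(\<integral>x. real_of_ereal (u (W x)) \<partial>measure_pmf p) = (\<Sum>s\<in>S. m s * snd s)"
      unfolding int_p by (intro sum.cong refl) (subst (3) w_eq, auto simp: W_def)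
    also have "\<dots> = r" using arg_cong[OF S(5), of snd] by (simp add: snd_sum)
    finally show ?thesis .
  qed
  ultimately show ?thesis using Q_prob by (intro that[of Q]) (auto simp: wasserstein_ball_def)
qed

text \<open>The entries of a selection vary independently, so the supremum of the sums is the sum of
  the suprema. This decouples the data points of a cluster and, in the extended-real version, also
  the clusters of the ambiguity set.\<close>

lemma sum_selection_bound:
  fixes F :: "'l \<Rightarrow> 'a \<Rightarrow> real"
  assumes J: "finite J" and ne: "\<And>l. l \<in> J \<Longrightarrow> A l \<noteq> {}"
    and le: "\<And>w. (\<And>l. l \<in> J \<Longrightarrow> w l \<in> A l) \<Longrightarrow> (\<Sum>l\<in>J. F l (w l)) \<le> M"
  obtains \<alpha> where "\<And>l w. l \<in> J \<Longrightarrow> w \<in> A l \<Longrightarrow> F l w \<le> \<alpha> l" "(\<Sum>l\<in>J. \<alpha> l) \<le> M"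
proof (rule that[of "\<lambda>l. Sup (F l ` A l)"])
  obtain v where v: "\<And>l. l \<in> J \<Longrightarrow> v l \<in> A l"
    by (rule that[of "\<lambda>l. SOME w. w \<in> A l"]) (simp add: some_in_eq ne)
  have bdd: "bdd_above (F l ` A l)" if l: "l \<in> J" for l
  proof (rule bdd_aboveI2)
    fix w assume w: "w \<in> A l"
    \<comment> \<open>Varying one entry of the fixed selection \<open>v\<close> bounds each
      \<open>F l\<close> separately, so its supremum is a real number.\<close>
    have "(\<Sum>j\<in>J. F j ((v(l := w)) j)) \<le> M" using v w by (intro le) auto
    moreover have "(\<Sum>j\<in>J. F j ((v(l := w)) j)) = F l w + (\<Sum>j\<in>J - {l}. F j (v j))"
      using J l by (simp add: sum.remove)
    ultimately show "F l w \<le> M - (\<Sum>j\<in>J - {l}. F j (v j))" by simp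
  qed
  then show "F l w \<le> Sup (F l ` A l)" if "l \<in> J" "w \<in> A l" for l w
    using that by (intro cSup_upper) auto
  show "(\<Sum>l\<in>J. Sup (F l ` A l)) \<le> M"
  proof (rule field_le_epsilon)
    fix e :: real assume e: "0 < e"
    \<comment> \<open>One \<open>e'\<close> is lost for each index; adding 1 in the denominator
      covers an empty \<open>J\<close>.\<close>
    define e' where "e' = e / (card J + 1)"
    have e': "0 < e'" using e by (simp add: e'_def)
    have "\<exists>w\<in>A l. Sup (F l ` A l) - e' < F l w" if "l \<in> J" for l
      using less_cSup_iff[of "F l ` A l" "Sup (F l ` A l) - e'"] bdd[OF that] ne[OF that] e' by auto
    then obtain w where w: "\<And>l. l \<in> J \<Longrightarrow> w l \<in> A l" "\<And>l. l \<in> J \<Longrightarrow> Sup (F l ` A l) - e' < F l (w l)"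
      by metis
    have "(\<Sum>l\<in>J. Sup (F l ` A l)) \<le> (\<Sum>l\<in>J. F l (w l) + e')"
      by (intro sum_mono) (use w(2) in force)
    also have "\<dots> = (\<Sum>l\<in>J. F l (w l)) + card J * e'" by (simp add: sum.distrib)
    also have "\<dots> \<le> M + e"
      using le[of w] w(1) e by (intro add_mono) (auto simp: e'_def field_simps)
    finally show "(\<Sum>l\<in>J. Sup (F l ` A l)) \<le> M + e" .
  qed
qed

text \<open>Either every index admits a value other than \<open>-\<infinity>\<close>, and the real
  version applies to those choices, or some index admits none and the hypothesis on sums is
  vacuous.\<close>

lemma sum_selection_bound_ereal:
  fixes F :: "'l \<Rightarrow> 'a \<Rightarrow> ereal"
  assumes J: "finite J" and B: "\<And>l w. l \<in> J \<Longrightarrow> w \<in> A l \<Longrightarrow> F l w \<le> ereal (B l)"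
    and le: "\<And>w. (\<And>l. l \<in> J \<Longrightarrow> w l \<in> A l \<and> F l (w l) \<noteq> - \<infinity>) \<Longrightarrow> (\<Sum>l\<in>J. real_of_ereal (F l (w l))) \<le> M"
  obtains \<alpha> where "\<And>l w. l \<in> J \<Longrightarrow> w \<in> A l \<Longrightarrow> F l w \<le> ereal (\<alpha> l)" "(\<Sum>l\<in>J. \<alpha> l) \<le> M"
proof (cases "\<forall>l\<in>J. {w \<in> A l. F l w \<noteq> - \<infinity>} \<noteq> {}")
  case True
  obtain \<alpha> where \<alpha>: "\<And>l w. l \<in> J \<Longrightarrow> w \<in> {w \<in> A l. F l w \<noteq> - \<infinity>} \<Longrightarrow> real_of_ereal (F l w) \<le> \<alpha> l"
    "(\<Sum>l\<in>J. \<alpha> l) \<le> M"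
  proof (rule sum_selection_bound[OF J, of "\<lambda>l. {w \<in> A l. F l w \<noteq> - \<infinity>}" "\<lambda>l w. real_of_ereal (F l w)" M])
    show "(\<Sum>l\<in>J. real_of_ereal (F l (w l))) \<le> M"
      if "\<And>l. l \<in> J \<Longrightarrow> w l \<in> {w \<in> A l. F l w \<noteq> - \<infinity>}" for w
      using that by (intro le) auto
  qed (use True in auto)
  show ?thesis
  proof (rule that[of \<alpha>])
    fix l w assume "l \<in> J" "w \<in> A l"
    then show "F l w \<le> ereal (\<alpha> l)" using \<alpha>(1)[of l w] B[of l w] by (cases "F l w") auto
  qed (rule \<alpha>(2))
next
  case False
  then obtain l0 where l0: "l0 \<in> J" "\<And>w. w \<in> A l0 \<Longrightarrow> F l0 w = - \<infinity>" by auto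
  show ?thesis
  \<comment> \<open>At \<open>l0\<close> any real is an upper bound, so it is chosen to make the
    total exactly \<open>M\<close>.\<close>
  proof (rule that[of "B(l0 := M - (\<Sum>l\<in>J - {l0}. B l))"])
    have "(\<Sum>l\<in>J - {l0}. (B(l0 := M - (\<Sum>l\<in>J - {l0}. B l))) l) = (\<Sum>l\<in>J - {l0}. B l)"
      by (intro sum.cong) auto
    then show "(\<Sum>l\<in>J. (B(l0 := M - (\<Sum>l\<in>J - {l0}. B l))) l) \<le> M"
      using l0(1) J by (simp add: sum.remove)
  qed (use l0 B in auto)
qed

text \<open>Where \<open>u\<close> reaches \<open>M\<close>, the distance from \<open>y\<close>
  exceeds \<open>d\<close>, and by compactness it exceeds \<open>d\<close> by a uniform \<delta>.
  Beyond that gap a steep penalty overtakes the linear growth; elsewhere \<open>u\<close> is below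
  \<open>M\<close> and the penalty is nonnegative on the domain of \<open>u\<close>.\<close>

lemma usc_penalty_bound:
  fixes nrm :: "'a::euclidean_space \<Rightarrow> real"
  assumes nrm: "is_norm nrm" and \<Xi>: "closed \<Xi>" and u: "upper_semicontinuous u"
    and growth: "\<And>w. w \<in> \<Xi> \<Longrightarrow> u w \<le> ereal (D + L * nrm (w - y))" and L: "0 \<le> L"
    and d: "\<And>w. w \<in> \<Xi> \<Longrightarrow> u w \<noteq> - \<infinity> \<Longrightarrow> d \<le> nrm (w - y)"
    and M: "\<And>w. w \<in> \<Xi> \<Longrightarrow> nrm (w - y) = d \<Longrightarrow> u w < ereal M"
  obtains lam0 where "0 \<le> lam0"
    "\<And>lam w. lam0 \<le> lam \<Longrightarrow> w \<in> \<Xi> \<Longrightarrow> u w \<le> ereal (M + lam * (nrm (w - y) - d))"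
proof -
  let ?K = "\<Xi> \<inter> {w. ereal M \<le> u w}"
  obtain \<delta> where \<delta>: "0 < \<delta>" "\<And>w. w \<in> ?K \<Longrightarrow> d + \<delta> \<le> nrm (w - y)"
  proof -
    \<comment> \<open>Truncation at radius \<open>d + 1\<close> gives compactness; points farther
      away satisfy the bound with gap 1.\<close>
    let ?K' = "?K \<inter> {w. nrm (w - y) \<le> d + 1}"
    obtain c where c: "0 < c" "\<And>w. norm w \<le> c * nrm w" using is_norm_dominates[OF nrm] by blast
    have "compact ?K'"
      unfolding compact_eq_bounded_closed
    proof
      show "closed ?K'"
        by (intro closed_Int \<Xi> closed_upper_level_set[OF u] closed_Collect_le
            is_norm_continuous_on_diff[OF nrm] continuous_on_const)
      have "?K' \<subseteq> cball y (c * (d + 1))"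
      proof
        fix w assume "w \<in> ?K'"
        then have "c * nrm (w - y) \<le> c * (d + 1)" using c(1) by simp
        then show "w \<in> cball y (c * (d + 1))"
          using c(2)[of "w - y"] by (simp add: dist_norm norm_minus_commute)
      qed
      then show "bounded ?K'" using bounded_cball bounded_subset by blast
    qed
    show ?thesis
    proof (cases "?K' = {}")
      case True
      then show ?thesis by (intro that[of 1]) (auto simp: disjoint_iff)
    next
      case False
      then obtain v where v: "v \<in> ?K'" "\<And>w. w \<in> ?K' \<Longrightarrow> nrm (v - y) \<le> nrm (w - y)"
        using continuous_attains_inf[OF \<open>compact ?K'\<close> False is_norm_continuous_on_diff[OF nrm]] by blast
      have "d \<le> nrm (v - y)" using v(1) by (intro d) auto
      moreover have "d \<noteq> nrm (v - y)" using v(1) M[of v] by auto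
      ultimately have "d < nrm (v - y)" by simp
      then show ?thesis
      proof (intro that[of "min 1 (nrm (v - y) - d)"])
        fix w assume "w \<in> ?K"
        then show "d + min 1 (nrm (v - y) - d) \<le> nrm (w - y)"
          using v(2)[of w] by (cases "nrm (w - y) \<le> d + 1") auto
      qed auto
    qed
  qed
  let ?E = "\<bar>D + L * d - M\<bar>"
  show ?thesis
  proof (rule that[of "L + ?E / \<delta>"])
    \<comment> \<open>Slope \<open>L\<close> matches the growth of the majorant, and the extra
      \<open>?E / \<delta>\<close> makes up the deficit \<open>D + L * d - M\<close> within distance
      \<delta>.\<close>
    show "0 \<le> L + ?E / \<delta>" using L \<delta>(1) by simp
    fix lam w assume lam: "L + ?E / \<delta> \<le> lam" and w: "w \<in> \<Xi>"
    show "u w \<le> ereal (M + lam * (nrm (w - y) - d))"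
    proof (cases "w \<in> ?K")
      case True
      have "?E \<le> ?E / \<delta> * (nrm (w - y) - d)"
        using \<delta>(2)[OF True] \<delta>(1) mult_left_mono[of \<delta> "nrm (w - y) - d" "?E / \<delta>"] by simp
      then have "D + L * nrm (w - y) \<le> M + (L + ?E / \<delta>) * (nrm (w - y) - d)"
        by (simp add: algebra_simps)
      also have "\<dots> \<le> M + lam * (nrm (w - y) - d)"
        using \<delta>(2)[OF True] \<delta>(1) by (intro add_left_mono mult_right_mono lam) auto
      finally show ?thesis using growth[OF w] by (meson ereal_less_eq(3) order_trans)
    next
      case False
      then have less: "u w < ereal M" using w by auto
      show ?thesis
      proof (cases "u w = - \<infinity>")
        case False
        have "0 \<le> L + ?E / \<delta>" using L \<delta>(1) by simp
        then have "0 \<le> lam * (nrm (w - y) - d)" using lam d[OF w False] by simp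
        then have "ereal M \<le> ereal (M + lam * (nrm (w - y) - d))" by simp
        with less show ?thesis by (meson less_imp_le order_trans)
      qed simp
    qed
  qed
qed

lemma wasserstein_strong_duality:
  fixes nrm :: "'a::euclidean_space \<Rightarrow> real" and data :: "'l::finite \<Rightarrow> 'a" and c :: "'l \<Rightarrow> 'k" and k :: 'k
  defines "C \<equiv> cluster c k"
  assumes nrm: "is_norm nrm" and ne: "C \<noteq> {}" and \<Xi>: "closed \<Xi>" and data: "\<And>l. data l \<in> \<Xi>"
    and u: "upper_semicontinuous u" and u_fin: "\<And>w. u w < \<infinity>"
    and growth: "\<And>l w. w \<in> \<Xi> \<Longrightarrow> u w \<le> ereal (D + L * nrm (w - data l))" and L: "0 \<le> L"
    and le: "\<And>Q. Q \<in> wasserstein_ball nrm \<Xi> (empirical data c k) \<theta> \<Longrightarrow> ereal_expectation Q u \<le> ereal M"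
    and e: "0 < e"
  obtains lam \<alpha> where "0 \<le> lam"
    "\<And>l w. l \<in> C \<Longrightarrow> w \<in> \<Xi> \<Longrightarrow> u w \<le> ereal (\<alpha> l + lam * nrm (w - data l))"
    "lam * \<theta> + (\<Sum>l\<in>C. \<alpha> l) / real (card C) \<le> M + e"
proof -
  let ?n = "real (card C)"
  have n: "0 < ?n" using ne by (simp add: card_gt_0_iff)
  let ?dom = "{w \<in> \<Xi>. u w \<noteq> - \<infinity>}"
  define A where "A = {((\<Sum>l\<in>C. nrm (w l - data l)) / card C, (\<Sum>l\<in>C. real_of_ereal (u (w l))) / card C) | w.
         \<forall>l\<in>C. w l \<in> \<Xi> \<and> u (w l) \<noteq> - \<infinity>}"
  have hull_le: "r \<le> M" if tr: "(t, r) \<in> convex hull A" and t: "t \<le> \<theta>" for t r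
  proof -
    obtain Q where "Q \<in> wasserstein_ball nrm \<Xi> (empirical data c k) \<theta>" "ereal_expectation Q u = ereal r"
      using hull_realised_in_wasserstein_ball[OF nrm ne[unfolded C_def] \<Xi> data
          upper_semicontinuous_measurable[OF u] u_fin tr[unfolded A_def C_def] t] by blast
    then show ?thesis using le[of Q] by simp
  qed
  have in_A: "((\<Sum>l\<in>C. nrm (w l - data l)) / ?n, (\<Sum>l\<in>C. real_of_ereal (u (w l))) / ?n) \<in> A"
    if "\<And>l. l \<in> C \<Longrightarrow> w l \<in> ?dom" for w
    unfolding A_def using that by blast
  show ?thesis
  proof (cases "?dom = {}")
    case True
    then show ?thesis using n e by (intro that[of 0 "\<lambda>_. M"]) auto
  next
    case False
    then obtain w0 where w0: "w0 \<in> ?dom" by blast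
    have "A \<noteq> {}" using in_A[of "\<lambda>_. w0"] w0 by blast
    then have "convex hull A \<noteq> {}" by simp
    moreover have "{..\<theta>} \<times> {M<..} \<noteq> {}" by (auto intro: exI[of _ "M + 1"])
    moreover have "convex hull A \<inter> {..\<theta>} \<times> {M<..} = {}" using hull_le by fastforce
    ultimately have "\<exists>p b. p \<noteq> 0 \<and> (\<forall>x\<in>convex hull A. p \<bullet> x \<le> b) \<and> (\<forall>x\<in>{..\<theta>} \<times> {M<..}. b \<le> p \<bullet> x)"
      by (intro separating_hyperplane_sets convex_convex_hull convex_Times convex_real_interval)
    then obtain p b where p: "p \<noteq> 0" "\<And>x. x \<in> convex hull A \<Longrightarrow> p \<bullet> x \<le> b"
        "\<And>x. x \<in> {..\<theta>} \<times> {M<..} \<Longrightarrow> b \<le> p \<bullet> x"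
      by blast
    obtain a s where ps: "p = (a, s)" by force
    \<comment> \<open>The quadrant is unbounded towards lower cost and higher loss, which fixes the
      signs of \<open>a\<close> and \<open>s\<close>.\<close>
    have T: "b \<le> a * (\<theta> - x) + s * (M + y)" if "0 \<le> x" "0 < y" for x y
      using p(3)[of "(\<theta> - x, M + y)"] that by (simp add: ps)
    have "0 \<le> s"
    proof (rule ccontr)
      assume "\<not> 0 \<le> s"
      define y where "y = (\<bar>b - a * \<theta> - s * M\<bar> + 1) / - s"
      have y: "0 < y" "s * y = - (\<bar>b - a * \<theta> - s * M\<bar> + 1)"
        using \<open>\<not> 0 \<le> s\<close> by (auto simp: y_def field_simps intro!: divide_pos_pos)
      show False using T[OF order_refl y(1)] y(2) by (simp add: algebra_simps)
    qed
    have "a \<le> 0"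
    proof (rule ccontr)
      assume "\<not> a \<le> 0"
      define x where "x = (\<bar>b - a * \<theta> - s * (M + 1)\<bar> + 1) / a"
      have x: "0 \<le> x" "a * x = \<bar>b - a * \<theta> - s * (M + 1)\<bar> + 1"
        using \<open>\<not> a \<le> 0\<close> by (auto simp: x_def)
      show False using T[OF x(1) zero_less_one] x(2) by (simp add: algebra_simps)
    qed
    have corner: "b \<le> a * \<theta> + s * M"
    proof (rule field_le_epsilon)
      fix e :: real assume e: "0 < e"
      have "s * (e / (s + 1)) \<le> e" using \<open>0 \<le> s\<close> e by (simp add: field_simps)
      then show "b \<le> a * \<theta> + s * M + e"
        using T[of 0 "e / (s + 1)"] e \<open>0 \<le> s\<close> by (simp add: distrib_left)
    qed
    \<comment> \<open>Clearing the averages turns the separating inequality into a bound on sums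
      with independent terms, ready for \<open>sum_selection_bound\<close>.\<close>
    have sel: "(\<Sum>l\<in>C. a * nrm (w l - data l) + s * real_of_ereal (u (w l))) \<le> ?n * (a * \<theta> + s * M)"
      if "\<And>l. l \<in> C \<Longrightarrow> w l \<in> ?dom" for w
    proof -
      have "a * ((\<Sum>l\<in>C. nrm (w l - data l)) / ?n) + s * ((\<Sum>l\<in>C. real_of_ereal (u (w l))) / ?n) \<le> b"
        using p(2)[OF hull_inc[OF in_A[OF that]]] by (simp add: ps)
      also note corner
      finally have "?n * (a * ((\<Sum>l\<in>C. nrm (w l - data l)) / ?n) + s * ((\<Sum>l\<in>C. real_of_ereal (u (w l))) / ?n))
          \<le> ?n * (a * \<theta> + s * M)"
        using n by (simp add: mult_left_mono)
      then show ?thesis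
        using ne by (simp add: sum.distrib sum_distrib_left[symmetric] distrib_left)
    qed
    show ?thesis
    proof (cases "s = 0")
      case False
      with \<open>0 \<le> s\<close> have s: "0 < s" by simp
      \<comment> \<open>The slope of the separating line: loss gained per unit of transport
        cost.\<close>
      let ?lam = "- a / s"
      have "(\<Sum>l\<in>C. real_of_ereal (u (w l)) - ?lam * nrm (w l - data l)) \<le> ?n * (M - ?lam * \<theta>)"
        if "\<And>l. l \<in> C \<Longrightarrow> w l \<in> ?dom" for w
      proof -
        have "(\<Sum>l\<in>C. real_of_ereal (u (w l)) - ?lam * nrm (w l - data l)) =
            (\<Sum>l\<in>C. a * nrm (w l - data l) + s * real_of_ereal (u (w l))) / s"
          unfolding sum_divide_distrib using s by (intro sum.cong) (auto simp: field_simps)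
        also have "\<dots> \<le> ?n * (a * \<theta> + s * M) / s"
          using s by (intro divide_right_mono sel that) auto
        also have "\<dots> = ?n * (M - ?lam * \<theta>)" using s by (simp add: field_simps)
        finally show ?thesis .
      qed
      then obtain \<alpha> where \<alpha>: "\<And>l w. l \<in> C \<Longrightarrow> w \<in> ?dom \<Longrightarrow> real_of_ereal (u w) - ?lam * nrm (w - data l) \<le> \<alpha> l"
          "(\<Sum>l\<in>C. \<alpha> l) \<le> ?n * (M - ?lam * \<theta>)"
        using sum_selection_bound[of C "\<lambda>_. ?dom" "\<lambda>l w. real_of_ereal (u w) - ?lam * nrm (w - data l)"
            "?n * (M - ?lam * \<theta>)"] w0 by (metis (no_types, lifting) empty_iff finite)
      show ?thesis
      proof (rule that[of ?lam \<alpha>])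
        show "0 \<le> ?lam" using s \<open>a \<le> 0\<close> by (simp add: field_simps)
        fix l w assume "l \<in> C" "w \<in> \<Xi>"
        then show "u w \<le> ereal (\<alpha> l + ?lam * nrm (w - data l))"
          using \<alpha>(1)[of l w] u_fin[of w] by (cases "u w") auto
      next
        have "(\<Sum>l\<in>C. \<alpha> l) / ?n \<le> M - ?lam * \<theta>" using \<alpha>(2) n by (simp add: field_simps)
        then show "?lam * \<theta> + (\<Sum>l\<in>C. \<alpha> l) / ?n \<le> M + e" using e by simp
      qed
    next
      \<comment> \<open>The separating line is vertical: the budget \<open>\<theta>\<close> at most suffices to move all mass into the
        effective domain of \<open>u\<close>. Here duality rests on upper semicontinuity and \<open>lam \<rightarrow> \<infinity>\<close>.\<close>
      case True
      with p(1) ps \<open>a \<le> 0\<close> have a: "a < 0" by (auto simp: zero_prod_def)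
      have "(\<Sum>l\<in>C. - nrm (w l - data l)) \<le> - (?n * \<theta>)" if "\<And>l. l \<in> C \<Longrightarrow> w l \<in> ?dom" for w
      proof -
        have "- a * (\<Sum>l\<in>C. - nrm (w l - data l)) \<le> - a * - (?n * \<theta>)"
          using sel[OF that] True by (simp add: sum_distrib_left sum_negf algebra_simps)
        then show ?thesis using a by (subst (asm) mult_le_cancel_left_pos) auto
      qed
      \<comment> \<open>Decoupling the total distance gives for each data point a lower bound
        \<open>d l = - d' l\<close> on its distance to the domain of \<open>u\<close>, with total at
        least \<open>?n * \<theta>\<close>.\<close>
      then obtain d' where d': "\<And>l w. l \<in> C \<Longrightarrow> w \<in> ?dom \<Longrightarrow> - nrm (w - data l) \<le> d' l"
          "(\<Sum>l\<in>C. d' l) \<le> - (?n * \<theta>)"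
        using sum_selection_bound[of C "\<lambda>_. ?dom" "\<lambda>l w. - nrm (w - data l)" "- (?n * \<theta>)"] w0
        by (metis (no_types, lifting) empty_iff finite)
      define d where "d l = - d' l" for l
      have d: "d l \<le> nrm (w - data l)" if "l \<in> C" "w \<in> \<Xi>" "u w \<noteq> - \<infinity>" for l w
        using d'(1)[of l w] that by (simp add: d_def)
      have sum_d: "?n * \<theta> \<le> (\<Sum>l\<in>C. d l)" using d'(2) by (simp add: d_def sum_negf)
      \<comment> \<open>If the \<open>d l\<close> exceed the budget in total, a large
        \<open>lam\<close> absorbs any values \<open>m l\<close>, so the growth bound suffices. If
        they exhaust it exactly, growing \<open>lam\<close> gains nothing and \<open>m\<close> must
        respect the bound \<open>M\<close>. Strictness is bought by adding 1 or
        \<open>e\<close>.\<close>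
      obtain m where m: "\<And>l w. l \<in> C \<Longrightarrow> w \<in> \<Xi> \<Longrightarrow> nrm (w - data l) = d l \<Longrightarrow> u w < ereal (m l)"
        and m_sum: "?n * \<theta> < (\<Sum>l\<in>C. d l) \<or> (\<Sum>l\<in>C. m l) \<le> ?n * (M + e)"
      proof (cases "?n * \<theta> < (\<Sum>l\<in>C. d l)")
        case True
        show ?thesis
        proof (rule that[of "\<lambda>l. D + L * d l + 1"])
          fix l w assume "w \<in> \<Xi>" "nrm (w - data l) = d l"
          then have "u w \<le> ereal (D + L * d l)" using growth[of w l] by simp
          also have "\<dots> < ereal (D + L * d l + 1)" by simp
          finally show "u w < ereal (D + L * d l + 1)" .
        qed (simp add: True)
      next
        case False
        then have eq: "(\<Sum>l\<in>C. d l) = ?n * \<theta>" using sum_d by simp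
        obtain m where m: "\<And>l w. l \<in> C \<Longrightarrow> w \<in> {w \<in> \<Xi>. nrm (w - data l) = d l} \<Longrightarrow> u w \<le> ereal (m l)"
            "(\<Sum>l\<in>C. m l) \<le> ?n * M"
        proof (rule sum_selection_bound_ereal[of C "\<lambda>l. {w \<in> \<Xi>. nrm (w - data l) = d l}" "\<lambda>_. u" "\<lambda>l. D + L * d l" "?n * M"])
          fix l w assume "w \<in> {w \<in> \<Xi>. nrm (w - data l) = d l}"
          then show "u w \<le> ereal (D + L * d l)" using growth[of w l] by simp
        next
          \<comment> \<open>Targets at exactly the distances \<open>d l\<close> have average cost
            \<theta>, so they are within the budget and \<open>hull_le\<close> bounds their average
            loss.\<close>
          fix w assume w: "\<And>l. l \<in> C \<Longrightarrow> w l \<in> {w \<in> \<Xi>. nrm (w - data l) = d l} \<and> u (w l) \<noteq> - \<infinity>"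
          have "(\<Sum>l\<in>C. nrm (w l - data l)) = ?n * \<theta>" unfolding eq[symmetric] using w by (intro sum.cong) auto
          then have "(\<Sum>l\<in>C. real_of_ereal (u (w l))) / ?n \<le> M"
            using n w by (intro hull_le[OF hull_inc[OF in_A[of w]]]) auto
          then show "(\<Sum>l\<in>C. real_of_ereal (u (w l))) \<le> ?n * M" using n by (simp add: field_simps)
        qed auto
        show ?thesis
        proof (rule that[of "\<lambda>l. m l + e"])
          fix l w assume "l \<in> C" "w \<in> \<Xi>" "nrm (w - data l) = d l"
          then have "u w \<le> ereal (m l)" by (intro m) auto
          also have "\<dots> < ereal (m l + e)" using e by simp
          finally show "u w < ereal (m l + e)" .
        qed (use m(2) in \<open>simp add: sum.distrib algebra_simps\<close>)
      qed
      have "\<exists>lam0\<ge>0. \<forall>lam\<ge>lam0. \<forall>w\<in>\<Xi>. u w \<le> ereal (m l + lam * (nrm (w - data l) - d l))" if l: "l \<in> C" for l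
        using usc_penalty_bound[OF nrm \<Xi> u growth L d[OF l] m[OF l]] by metis
      then obtain lam0 where lam0: "\<And>l. l \<in> C \<Longrightarrow> 0 \<le> lam0 l"
        "\<And>l lam w. l \<in> C \<Longrightarrow> lam0 l \<le> lam \<Longrightarrow> w \<in> \<Xi> \<Longrightarrow> u w \<le> ereal (m l + lam * (nrm (w - data l) - d l))"
        by metis
      \<comment> \<open>The sum of the nonnegative thresholds \<open>lam0 l\<close> dominates each
        of them. If there is a positive gap \<open>?g\<close>, the other entry of the maximum solves
        the value inequality for \<open>lam\<close>.\<close>
      obtain lam where lam: "(\<Sum>l\<in>C. lam0 l) \<le> lam" "lam * (?n * \<theta> - (\<Sum>l\<in>C. d l)) + (\<Sum>l\<in>C. m l) \<le> ?n * (M + e)"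
      proof (cases "?n * \<theta> < (\<Sum>l\<in>C. d l)")
        case False
        then have "?n * \<theta> - (\<Sum>l\<in>C. d l) = 0" using sum_d by simp
        then show ?thesis using m_sum False by (intro that[of "\<Sum>l\<in>C. lam0 l"]) simp_all
      next
        case True
        let ?g = "(\<Sum>l\<in>C. d l) - ?n * \<theta>"
        let ?lam = "max (\<Sum>l\<in>C. lam0 l) (((\<Sum>l\<in>C. m l) - ?n * (M + e)) / ?g)"
        have "((\<Sum>l\<in>C. m l) - ?n * (M + e)) / ?g * ?g \<le> ?lam * ?g"
          using True by (intro mult_right_mono) auto
        then have "(\<Sum>l\<in>C. m l) - ?n * (M + e) \<le> ?lam * ?g" using True by simp
        then show ?thesis by (intro that[of ?lam]) (auto simp: algebra_simps)
      qed
      have lam_ge: "lam0 l \<le> lam" if "l \<in> C" for l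
        using lam(1) member_le_sum[of l C lam0] lam0(1) that by (auto intro: order_trans)
      show ?thesis
      proof (rule that[of lam "\<lambda>l. m l - lam * d l"])
        show "0 \<le> lam" using lam(1) sum_nonneg[of C lam0] lam0(1) by auto
        fix l w assume "l \<in> C" "w \<in> \<Xi>"
        then show "u w \<le> ereal (m l - lam * d l + lam * nrm (w - data l))"
          using lam0(2)[of l lam w] lam_ge[of l] by (simp add: algebra_simps)
      next
        have sum_eq: "(\<Sum>l\<in>C. m l - lam * d l) = (\<Sum>l\<in>C. m l) - lam * (\<Sum>l\<in>C. d l)"
          by (simp add: sum_subtractf sum_distrib_left)
        have scale: "?n * (x + S / ?n) = ?n * x + S" for x S using ne by (simp add: distrib_left)
        have "?n * (lam * \<theta> + (\<Sum>l\<in>C. m l - lam * d l) / ?n) = lam * (?n * \<theta> - (\<Sum>l\<in>C. d l)) + (\<Sum>l\<in>C. m l)"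
          unfolding scale sum_eq by (simp only: right_diff_distrib mult.left_commute[of lam ?n])
        then have "?n * (lam * \<theta> + (\<Sum>l\<in>C. m l - lam * d l) / ?n) \<le> ?n * (M + e)"
          using lam(2) by (simp only:)
        then show "lam * \<theta> + (\<Sum>l\<in>C. m l - lam * d l) / ?n \<le> M + e"
          using n by (rule mult_left_le_imp_le)
      qed
    qed
  qed
qed

subsection \<open>The reformulation\<close>

lemma MAX_upper_semicontinuous:
  fixes h :: "'i::finite \<Rightarrow> 'a::topological_space \<Rightarrow> ereal"
  assumes "\<And>i. upper_semicontinuous (h i)"
  shows "upper_semicontinuous (\<lambda>w. MAX i. h i w)"
  using assms unfolding upper_semicontinuous_def by (simp add: eventually_all_finite)

text \<open>The affine majorants of the finitely many pieces share the constants obtained by summing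
  the norms of their slopes and their absolute offsets. The data term in \<open>D\<close> pays for
  centring the bound at any data point.\<close>

lemma concave_usc_linear_growth:
  fixes h :: "'i::finite \<Rightarrow> 'a::euclidean_space \<Rightarrow> ereal" and data :: "'l::finite \<Rightarrow> 'a"
  assumes nrm: "is_norm nrm" and "\<And>i. ereal_concave (h i)" "\<And>i. upper_semicontinuous (h i)" "\<And>i w. h i w < \<infinity>"
  obtains D L where "0 \<le> L" "\<And>l w. (MAX i. h i w) \<le> ereal (D + L * nrm (w - data l))"
proof -
  obtain c where c: "0 < c" "\<And>w. norm w \<le> c * nrm w" using is_norm_dominates[OF nrm] by blast
  have "\<exists>y b. \<forall>w. h i w \<le> ereal (y \<bullet> w + b)" for i
    using concave_usc_affine_majorant[OF assms(2-4), of i] by metis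
  then obtain y b where yb: "\<And>i w. h i w \<le> ereal (y i \<bullet> w + b i)" by metis
  define L where "L = (\<Sum>i\<in>UNIV. norm (y i))"
  define D where "D = (\<Sum>i\<in>UNIV. \<bar>b i\<bar>) + L * (\<Sum>l\<in>UNIV. norm (data l))"
  have L: "0 \<le> L" by (simp add: L_def sum_nonneg)
  show ?thesis
  proof (rule that[of "L * c" D])
    show "0 \<le> L * c" using c(1) L by simp
    fix l w
    have "y i \<bullet> w + b i \<le> D + L * c * nrm (w - data l)" for i
    proof -
      have "y i \<bullet> w \<le> norm (y i) * norm w" by (rule norm_cauchy_schwarz)
      also have "\<dots> \<le> L * (norm (data l) + norm (w - data l))"
        using norm_triangle_ineq[of "data l" "w - data l"] unfolding L_def
        by (intro mult_mono member_le_sum sum_nonneg) auto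
      also have "\<dots> \<le> L * ((\<Sum>l\<in>UNIV. norm (data l)) + c * nrm (w - data l))"
        by (intro mult_left_mono add_mono c L member_le_sum) auto
      finally have "y i \<bullet> w \<le> L * (\<Sum>l\<in>UNIV. norm (data l)) + L * c * nrm (w - data l)"
        by (simp add: algebra_simps)
      moreover have "b i \<le> (\<Sum>i\<in>UNIV. \<bar>b i\<bar>)"
        using member_le_sum[of i UNIV "\<lambda>i. \<bar>b i\<bar>"] by simp
      ultimately show ?thesis by (simp add: D_def)
    qed
    then have "h i w \<le> ereal (D + L * c * nrm (w - data l))" for i
      by (meson yb ereal_less_eq(3) order_trans)
    then show "(MAX i. h i w) \<le> ereal (D + L * c * nrm (w - data l))" by simp
  qed
qed

text \<open>The delicate case is \<open>c = -\<infinity>\<close>: for nonempty \<open>Y\<close> the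
  infimum of reals is below \<open>\<infinity>\<close> and both sides are
  \<open>-\<infinity>\<close>, while for empty \<open>Y\<close> both sides are
  \<open>\<infinity>\<close>, as infeasibility demands.\<close>

lemma INF_ereal_add_left:
  fixes c :: ereal
  shows "(INF y\<in>Y. c + ereal (v y)) = c + (INF y\<in>Y. ereal (v y))"
proof (cases "Y = {}")
  case False
  show ?thesis
  proof (cases c)
    case (real r)
    show ?thesis
    proof (rule antisym)
      have "(INF y\<in>Y. c + ereal (v y)) - c \<le> (INF y\<in>Y. ereal (v y))"
        using real by (intro INF_greatest) (auto simp: ereal_minus_le_iff add.commute intro: INF_lower2)
      then show "(INF y\<in>Y. c + ereal (v y)) \<le> c + (INF y\<in>Y. ereal (v y))"
        using real by (simp add: ereal_minus_le_iff add.commute)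
      show "c + (INF y\<in>Y. ereal (v y)) \<le> (INF y\<in>Y. c + ereal (v y))"
        by (intro INF_greatest add_left_mono INF_lower)
    qed
  next
    case MInf
    obtain y where "y \<in> Y" using False by blast
    then have "(INF y\<in>Y. ereal (v y)) \<le> ereal (v y)" by (rule INF_lower)
    then have "(INF y\<in>Y. ereal (v y)) \<noteq> \<infinity>" by auto
    then show ?thesis using MInf False by (cases "INF y\<in>Y. ereal (v y)") auto
  qed (use False in auto)
qed (simp add: top_ereal_def)

section \<open>Duality over the ambiguity set\<close>

lemma wasserstein_ball_sets:
  "Q \<in> wasserstein_ball nrm \<Xi> P \<theta> \<Longrightarrow> sets Q = sets borel"
  by (simp add: wasserstein_ball_def prob_measures_on_def)

lemma ambiguity_weak_duality:
  fixes nrm :: "'a::euclidean_space \<Rightarrow> real" and data :: "'l::finite \<Rightarrow> 'a" and c :: "'l \<Rightarrow> 'k::finite"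
  assumes nrm: "is_norm nrm" and ne: "\<And>k. cluster c k \<noteq> {}" and \<theta>: "\<And>k. 0 \<le> \<theta> k"
    and u: "u \<in> borel_measurable borel" and lam: "\<And>k. 0 \<le> lam k"
    and le: "\<And>l w. w \<in> \<Xi> \<Longrightarrow> u w \<le> ereal (\<alpha> l + lam (c l) * nrm (w - data l))"
    and Q: "Q \<in> ambiguity_set nrm \<Xi> data c \<theta>"
  shows "ereal_expectation Q u \<le> ereal (\<Sum>k\<in>UNIV. real (card (cluster c k)) / real CARD('l) *
      (lam k * \<theta> k + (\<Sum>l\<in>cluster c k. \<alpha> l) / real (card (cluster c k))))"
proof -
  let ?p = "\<lambda>k. real (card (cluster c k)) / real CARD('l)"
  obtain R where Q: "Q = mixture UNIV ?p R"
    and R: "\<And>k. R k \<in> wasserstein_ball nrm \<Xi> (empirical data c k) (\<theta> k)"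
    using Q unfolding ambiguity_set_def by blast
  have le_k: "u w \<le> ereal (\<alpha> l + lam k * nrm (w - data l))" if "l \<in> cluster c k" "w \<in> \<Xi>" for k l w
    using le[of w l] that by (simp add: cluster_def)
  note weak = wasserstein_weak_duality[OF nrm ne R \<theta> u lam le_k]
  have "ereal_expectation Q u = (\<Sum>k\<in>UNIV. ereal (?p k) * ereal_expectation (R k) u)"
    unfolding Q using weak(1) wasserstein_ball_sets[OF R] u by (intro ereal_expectation_mixture) auto
  also have "\<dots> \<le> (\<Sum>k\<in>UNIV. ereal (?p k) * ereal (lam k * \<theta> k + (\<Sum>l\<in>cluster c k. \<alpha> l) / real (card (cluster c k))))"
    using weak(2) by (intro sum_mono ereal_mult_left_mono) auto
  finally show ?thesis by simp
qed

text \<open>The distributions of the clusters range independently over their balls, so the bound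
  \<open>M\<close> on mixtures splits into bounds \<beta> on the weighted expectations of single
  clusters, and the duality of each ball applies.\<close>

lemma ambiguity_strong_duality:
  fixes nrm :: "'a::euclidean_space \<Rightarrow> real" and data :: "'l::finite \<Rightarrow> 'a" and c :: "'l \<Rightarrow> 'k::finite"
  assumes nrm: "is_norm nrm" and ne: "\<And>k. cluster c k \<noteq> {}" and \<theta>: "\<And>k. 0 \<le> \<theta> k"
    and \<Xi>: "closed \<Xi>" and data: "\<And>l. data l \<in> \<Xi>"
    and u: "upper_semicontinuous u" and u_fin: "\<And>w. u w < \<infinity>"
    and growth: "\<And>l w. w \<in> \<Xi> \<Longrightarrow> u w \<le> ereal (D + L * nrm (w - data l))" and L: "0 \<le> L"
    and le: "\<And>Q. Q \<in> ambiguity_set nrm \<Xi> data c \<theta> \<Longrightarrow> ereal_expectation Q u \<le> ereal M"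
    and e: "0 < e"
  obtains lam \<alpha> where "\<And>k. 0 \<le> lam k"
    "\<And>l w. w \<in> \<Xi> \<Longrightarrow> u w \<le> ereal (\<alpha> l + lam (c l) * nrm (w - data l))"
    "(\<Sum>k\<in>UNIV. real (card (cluster c k)) / real CARD('l) *
      (lam k * \<theta> k + (\<Sum>l\<in>cluster c k. \<alpha> l) / real (card (cluster c k)))) \<le> M + e"
proof -
  let ?p = "\<lambda>k. real (card (cluster c k)) / real CARD('l)"
  let ?ball = "\<lambda>k. wasserstein_ball nrm \<Xi> (empirical data c k) (\<theta> k)"
  have p: "0 < ?p k" for k using ne[of k] by (simp add: card_gt_0_iff)
  note meas = upper_semicontinuous_measurable[OF u]
  \<comment> \<open>The growth bound is itself dual feasible, with multiplier \<open>L\<close> and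
    constant value \<open>D\<close>, so expectations over each ball are bounded above.\<close>
  have weak: "(\<integral>\<^sup>+ w. e2ennreal (u w) \<partial>Q) < \<infinity>"
      "ereal_expectation Q u \<le> ereal (L * \<theta> k + (\<Sum>l\<in>cluster c k. D) / real (card (cluster c k)))"
    if "Q \<in> ?ball k" for k Q
    using wasserstein_weak_duality[OF nrm ne that \<theta> meas L, where \<alpha> = "\<lambda>_. D"] growth by blast+
  obtain \<beta> where \<beta>: "\<And>k Q. k \<in> UNIV \<Longrightarrow> Q \<in> ?ball k \<Longrightarrow> ereal (?p k) * ereal_expectation Q u \<le> ereal (\<beta> k)"
    "(\<Sum>k\<in>UNIV. \<beta> k) \<le> M"
  proof (rule sum_selection_bound_ereal[of UNIV ?ball "\<lambda>k Q. ereal (?p k) * ereal_expectation Q u"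
        "\<lambda>k. ?p k * (L * \<theta> k + (\<Sum>l\<in>cluster c k. D) / real (card (cluster c k)))" M])
    fix k Q assume "Q \<in> ?ball k"
    then have "ereal_expectation Q u \<le> ereal (L * \<theta> k + (\<Sum>l\<in>cluster c k. D) / real (card (cluster c k)))"
      by (rule weak(2))
    then show "ereal (?p k) * ereal_expectation Q u
        \<le> ereal (?p k * (L * \<theta> k + (\<Sum>l\<in>cluster c k. D) / real (card (cluster c k))))"
      using p[of k] unfolding times_ereal.simps(1)[symmetric] by (intro ereal_mult_left_mono) auto
  next
    fix Q assume Q: "\<And>k. k \<in> UNIV \<Longrightarrow> Q k \<in> ?ball k \<and> ereal (?p k) * ereal_expectation (Q k) u \<noteq> - \<infinity>"
    have fin: "(\<integral>\<^sup>+ w. e2ennreal (u w) \<partial>Q k) < \<infinity>" for k using weak(1) Q by blast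
    have sets: "sets (Q k) = sets borel" for k using Q[of k] wasserstein_ball_sets by blast
    \<comment> \<open>The value \<open>-\<infinity>\<close> is excluded by the choice of
      \<open>Q\<close> and \<open>\<infinity>\<close> by \<open>weak\<close>, so the real sum is the
      expectation of the mixture.\<close>
    have real: "ereal (real_of_ereal (ereal (?p k) * ereal_expectation (Q k) u)) = ereal (?p k) * ereal_expectation (Q k) u" for k
    proof -
      have "ereal_expectation (Q k) u \<noteq> \<infinity>" using weak(2)[of "Q k" k] Q by auto
      then have "ereal (?p k) * ereal_expectation (Q k) u \<noteq> \<infinity>" using p[of k] by (cases "ereal_expectation (Q k) u") auto
      with Q[of k] show ?thesis by (intro ereal_real') auto
    qed
    have "ereal (\<Sum>k\<in>UNIV. real_of_ereal (ereal (?p k) * ereal_expectation (Q k) u)) =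
        (\<Sum>k\<in>UNIV. ereal (?p k) * ereal_expectation (Q k) u)"
      unfolding sum_ereal[symmetric] real ..
    also have "\<dots> = ereal_expectation (mixture UNIV ?p Q) u"
      by (intro ereal_expectation_mixture[symmetric] sets fin meas) auto
    also have "\<dots> \<le> ereal M" using Q by (intro le) (auto simp: ambiguity_set_def)
    finally show "(\<Sum>k\<in>UNIV. real_of_ereal (ereal (?p k) * ereal_expectation (Q k) u)) \<le> M" by simp
  qed (rule finite, blast)
  \<comment> \<open>Weighted by \<open>?p k\<close>, each cluster contributes
    \<open>e / CARD('k)\<close> to the total slack.\<close>
  define e' where "e' k = e / (?p k * CARD('k))" for k
  have e': "0 < e' k" for k
    unfolding e'_def by (intro divide_pos_pos[OF e] mult_pos_pos p) simp
  define dual where "dual k lam \<alpha> \<longleftrightarrow> 0 \<le> lam \<and>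
      (\<forall>l\<in>cluster c k. \<forall>w\<in>\<Xi>. u w \<le> ereal (\<alpha> l + lam * nrm (w - data l))) \<and>
      lam * \<theta> k + (\<Sum>l\<in>cluster c k. \<alpha> l) / real (card (cluster c k)) \<le> \<beta> k / ?p k + e' k" for k lam \<alpha>
  have "\<forall>k. \<exists>lam \<alpha>. dual k lam \<alpha>"
  proof
    fix k
    have divide: "E \<le> ereal (b / q)" if "ereal q * E \<le> ereal b" "0 < q" for q b E
      using that by (cases E) (auto simp: pos_le_divide_eq mult.commute)
    have bound: "ereal_expectation Q u \<le> ereal (\<beta> k / ?p k)" if "Q \<in> ?ball k" for Q
      by (rule divide[OF \<beta>(1)[OF UNIV_I that] p])
    show "\<exists>lam \<alpha>. dual k lam \<alpha>"
    proof (rule wasserstein_strong_duality[where data = data, OF nrm ne \<Xi> data u u_fin growth L bound e'])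
      fix lam \<alpha>
      assume "0 \<le> lam" "\<And>l w. l \<in> cluster c k \<Longrightarrow> w \<in> \<Xi> \<Longrightarrow> u w \<le> ereal (\<alpha> l + lam * nrm (w - data l))"
        "lam * \<theta> k + (\<Sum>l\<in>cluster c k. \<alpha> l) / real (card (cluster c k)) \<le> \<beta> k / ?p k + e' k"
      then have "dual k lam \<alpha>" unfolding dual_def by simp
      then show ?thesis by blast
    qed
  qed
  then obtain lam \<alpha> where "\<And>k. dual k (lam k) (\<alpha> k)" by metis
  then have lam: "\<And>k. 0 \<le> lam k"
    and \<alpha>: "\<And>k l w. l \<in> cluster c k \<Longrightarrow> w \<in> \<Xi> \<Longrightarrow> u w \<le> ereal (\<alpha> k l + lam k * nrm (w - data l))"
    and val: "\<And>k. lam k * \<theta> k + (\<Sum>l\<in>cluster c k. \<alpha> k l) / real (card (cluster c k)) \<le> \<beta> k / ?p k + e' k"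
    unfolding dual_def by blast+
  show ?thesis
  proof (rule that[of lam "\<lambda>l. \<alpha> (c l) l"])
    show "u w \<le> ereal (\<alpha> (c l) l + lam (c l) * nrm (w - data l))" if "w \<in> \<Xi>" for l w
      using that by (intro \<alpha>) (auto simp: cluster_def)
    have "(\<Sum>l\<in>cluster c k. \<alpha> (c l) l) = (\<Sum>l\<in>cluster c k. \<alpha> k l)" for k
      by (intro sum.cong) (auto simp: cluster_def)
    then have "(\<Sum>k\<in>UNIV. ?p k * (lam k * \<theta> k + (\<Sum>l\<in>cluster c k. \<alpha> (c l) l) / real (card (cluster c k))))
        \<le> (\<Sum>k\<in>UNIV. ?p k * (\<beta> k / ?p k + e' k))"
      using val p by (intro sum_mono mult_left_mono) (auto simp: less_imp_le)
    also have "\<dots> = (\<Sum>k\<in>UNIV. \<beta> k + e / CARD('k))"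
    proof (intro sum.cong refl)
      fix k
      have "x * (y / x + e / (x * CARD('k))) = y + e / CARD('k)" if "0 < x" for x y :: real
        using that by (simp add: field_simps)
      from this[OF p[of k]] show "?p k * (\<beta> k / ?p k + e' k) = \<beta> k + e / CARD('k)" unfolding e'_def .
    qed
    also have "\<dots> \<le> M + e" using \<beta>(2) by (simp add: sum.distrib)
    finally show "(\<Sum>k\<in>UNIV. ?p k * (lam k * \<theta> k + (\<Sum>l\<in>cluster c k. \<alpha> (c l) l) / real (card (cluster c k)))) \<le> M + e" .
  qed (rule lam)
qed

lemma reform_value_eq_primal:
  fixes X :: "(real^'n) set" and \<Xi> :: "(real^'m) set" and nrm :: "real^'m \<Rightarrow> real"
    and h :: "'i::finite \<Rightarrow> real^'n \<Rightarrow> real^'m \<Rightarrow> ereal"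
    and data :: "'l::finite \<Rightarrow> real^'m" and c :: "'l \<Rightarrow> 'k::finite"
    and f :: "real^'n \<Rightarrow> ereal" and \<theta> :: "'k \<Rightarrow> real"
  defines "feas \<equiv> (reform_feasible X \<Xi> nrm data c h :: ('n, 'm, 'k, 'l, 'i) decision set)"
    and "obj \<equiv> (reform_objective f c \<theta> :: ('n, 'm, 'k, 'l, 'i) decision \<Rightarrow> ereal)"
  assumes nrm: "is_norm nrm" and \<Xi>: "convex \<Xi>" "closed \<Xi>" and data: "\<And>l. data l \<in> \<Xi>"
    and ne: "\<And>k. cluster c k \<noteq> {}" and \<theta>: "\<And>k. 0 \<le> \<theta> k" and x: "x \<in> X"
    and h_fin: "\<And>i w. h i x w < \<infinity>" and h_usc: "\<And>i. upper_semicontinuous (h i x)"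
    and h_concave: "\<And>i. ereal_concave (h i x)"
  shows "(INF y\<in>{y. (x, y) \<in> feas}. obj (x, y)) =
    f x + (SUP Q\<in>ambiguity_set nrm \<Xi> data c \<theta>. ereal_expectation Q (\<lambda>w. MAX i. h i x w))"
proof -
  let ?Y = "{y. (x, y) \<in> feas}"
  let ?u = "\<lambda>w. MAX i. h i x w"
  let ?E = "SUP Q\<in>ambiguity_set nrm \<Xi> data c \<theta>. ereal_expectation Q ?u"
  \<comment> \<open>The part of the objective that is always real; \<open>f x\<close>, possibly
    infinite, is taken out of the infimum at the end.\<close>
  define val where "val = (\<lambda>(lam :: real^'k, \<alpha> :: real^'l, z :: ((real^'m)^'i)^'l, v :: ((real^'m)^'i)^'l).
    \<Sum>k\<in>UNIV. real (card (cluster c k)) / real CARD('l) *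
       (lam $ k * \<theta> k + (\<Sum>l\<in>cluster c k. \<alpha> $ l) / real (card (cluster c k))))"
  have obj: "obj (x, y) = f x + ereal (val y)" for y
    by (cases y) (simp add: obj_def reform_objective_def val_def sum_divide_distrib)
  have usc: "upper_semicontinuous ?u" by (rule MAX_upper_semicontinuous) (rule h_usc)
  have fin: "?u w < \<infinity>" for w using h_fin by (subst Max_less_iff) auto
  obtain D L where L: "0 \<le> L" and growth: "\<And>l w. ?u w \<le> ereal (D + L * nrm (w - data l))"
    by (rule concave_usc_linear_growth[of nrm "\<lambda>i. h i x" data, OF nrm h_concave h_usc h_fin]) (rule that)
  have "(INF y\<in>?Y. ereal (val y)) = ?E"
  proof (rule antisym)
    show "?E \<le> (INF y\<in>?Y. ereal (val y))"
    proof (intro INF_greatest SUP_least)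
      fix y Q assume y: "y \<in> ?Y" and Q: "Q \<in> ambiguity_set nrm \<Xi> data c \<theta>"
      obtain lam \<alpha> z v where y_eq: "y = (lam, \<alpha>, z, v)" by (cases y)
      have le: "h i x w \<le> ereal (\<alpha> $ l + lam $ c l * nrm (w - data l))" if "w \<in> \<Xi>" for i l w
        using y that unfolding y_eq feas_def mem_Collect_eq reform_feasible_iff
        by (intro conjugate_constraint_imp_le[OF nrm, of \<Xi> "h i x" "z $ l $ i" "v $ l $ i"]) auto
      have "0 \<le> lam $ k" for k using y unfolding y_eq feas_def mem_Collect_eq reform_feasible_iff by auto
      then show "ereal_expectation Q ?u \<le> ereal (val y)"
        unfolding val_def y_eq prod.case
        by (intro ambiguity_weak_duality[where lam = "\<lambda>k. lam $ k" and \<alpha> = "\<lambda>l. \<alpha> $ l", OF nrm ne \<theta> _ _ _ Q]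
            upper_semicontinuous_measurable usc) (use le in auto)
    qed
    show "(INF y\<in>?Y. ereal (val y)) \<le> ?E"
    \<comment> \<open>Testing against real upper bounds \<open>M\<close> covers infinite values of
      \<open>?E\<close>: for \<open>\<infinity>\<close> there is no such \<open>M\<close>, for
      \<open>-\<infinity>\<close> every real is one.\<close>
    proof (rule ereal_le_real)
      fix M assume "?E \<le> ereal M"
      then have le: "ereal_expectation Q ?u \<le> ereal M" if "Q \<in> ambiguity_set nrm \<Xi> data c \<theta>" for Q
        using SUP_upper[OF that, of "\<lambda>Q. ereal_expectation Q ?u"] by (rule order_trans[rotated])
      show "(INF y\<in>?Y. ereal (val y)) \<le> ereal M"
      proof (rule ereal_le_epsilon2)
        fix e :: real assume e: "0 < e"
        obtain lam \<alpha> where lam: "\<And>k. 0 \<le> lam k"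
          and \<alpha>: "\<And>l w. w \<in> \<Xi> \<Longrightarrow> ?u w \<le> ereal (\<alpha> l + lam (c l) * nrm (w - data l))"
          and val_le: "(\<Sum>k\<in>UNIV. real (card (cluster c k)) / real CARD('l) *
            (lam k * \<theta> k + (\<Sum>l\<in>cluster c k. \<alpha> l) / real (card (cluster c k)))) \<le> M + e"
          by (rule ambiguity_strong_duality[where data = data and \<theta> = \<theta>, OF nrm ne \<theta> \<Xi>(2) data usc fin growth L le e]) (assumption, rule that)
        \<comment> \<open>A bound on the maximum is a bound on each piece, so each pair of data
          point and piece receives its own vector.\<close>
        have "\<exists>z. dual_norm nrm z \<le> lam (c l) \<and>
            conjugate_on \<Xi> (\<lambda>w. - h i x w) (z - 0) + support_fun \<Xi> 0 - ereal (z \<bullet> data l) \<le> ereal (\<alpha> l)" for l i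
        proof -
          have "h i x w \<le> ereal (\<alpha> l + lam (c l) * nrm (w - data l))" if "w \<in> \<Xi>" for w
            using \<alpha>[OF that, of l] by simp
          from le_imp_conjugate_constraint[OF nrm h_concave \<Xi>(1) lam data this]
          obtain z where "dual_norm nrm z \<le> lam (c l)"
            "conjugate_on \<Xi> (\<lambda>w. - h i x w) (z - 0) + support_fun \<Xi> 0 - ereal (z \<bullet> data l) \<le> ereal (\<alpha> l)"
            by metis
          then show ?thesis by blast
        qed
        then obtain z where z: "\<And>l i. dual_norm nrm (z l i) \<le> lam (c l)"
          "\<And>l i. conjugate_on \<Xi> (\<lambda>w. - h i x w) (z l i - 0) + support_fun \<Xi> 0 - ereal (z l i \<bullet> data l) \<le> ereal (\<alpha> l)"
          by metis
        let ?y = "(\<chi> k. lam k, \<chi> l. \<alpha> l, \<chi> l i. z l i, 0) :: (real, 'k) vec \<times> (real, 'l) vec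
          \<times> (((real, 'm) vec, 'i) vec, 'l) vec \<times> (((real, 'm) vec, 'i) vec, 'l) vec"
        have "?y \<in> ?Y"
          unfolding mem_Collect_eq feas_def reform_feasible_iff using z lam x by simp
        then have "(INF y\<in>?Y. ereal (val y)) \<le> ereal (val ?y)" by (rule INF_lower)
        also have "\<dots> \<le> ereal M + ereal e" using val_le by (simp add: val_def)
        finally show "(INF y\<in>?Y. ereal (val y)) \<le> ereal M + ereal e" .
      qed
    qed
  qed
  then show ?thesis unfolding obj INF_ereal_add_left by simp
qed

text \<open>The first conjunct compares values on each fibre over a fixed \<open>x\<close>, the
  second globally. The last one ties \<open>feas\<close> to the constraint functions in
  \<open>cons\<close>, so that the convexity asserted before it concerns the very program whose
  value is computed.\<close>

theorem theorem5:
  fixes X :: "(real^'n) set"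
    and \<Xi> :: "(real^'m) set"
    and nrm :: "real^'m \<Rightarrow> real"
    and f :: "real^'n \<Rightarrow> ereal"
    and g :: "real^'n \<Rightarrow> real^'m \<Rightarrow> ereal"
    and h :: "'i::finite \<Rightarrow> real^'n \<Rightarrow> real^'m \<Rightarrow> ereal"
    and data :: "'l::finite \<Rightarrow> real^'m"
    and c :: "'l \<Rightarrow> 'k::finite"
    and \<theta> :: "'k \<Rightarrow> real"
  assumes "is_norm nrm"
    and "convex X" and "closed X"
    and "convex \<Xi>" and "closed \<Xi>"
    and "\<forall>l. data l \<in> \<Xi>"
    and "\<forall>k. cluster c k \<noteq> {}"
    and "\<forall>k. \<theta> k > 0"
    and "ereal_convex f"
    and "\<forall>x w. g x w = (MAX i. h i x w)"
    and h_proper: "\<forall>i. (\<forall>x\<in>X. \<forall>w. h i x w < \<infinity>) \<and> (\<exists>x w. - \<infinity> < h i x w)"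
    and h_usc: "\<forall>i. \<forall>x\<in>X. upper_semicontinuous (\<lambda>w. h i x w)"
    and h_convex: "\<forall>i w. ereal_convex (\<lambda>x. h i x w)"
    and h_concave: "\<forall>i. \<forall>x\<in>X. ereal_concave (\<lambda>w. h i x w)"
  defines "primal \<equiv> \<lambda>x. f x +
      (SUP Q\<in>ambiguity_set nrm \<Xi> data c \<theta>. ereal_expectation Q (\<lambda>w. g x w))"
    and "feas \<equiv> (reform_feasible X \<Xi> nrm data c h :: ('n, 'm, 'k, 'l, 'i) decision set)"
    and "obj \<equiv> (reform_objective f c \<theta> :: ('n, 'm, 'k, 'l, 'i) decision \<Rightarrow> ereal)"
    and "cons \<equiv> (reform_constraints \<Xi> nrm data c h :: (('n, 'm, 'k, 'l, 'i) decision \<Rightarrow> ereal) set)"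
  shows "(\<forall>x\<in>X. (INF y\<in>{y. (x, y) \<in> feas}. obj (x, y)) = primal x) \<and>
         (INF x\<in>X. primal x) = (INF d\<in>feas. obj d) \<and>
         finite_convex_program (X \<times> UNIV) obj cons \<and>
         feas = program_feasible (X \<times> UNIV) cons"
proof (intro conjI)
  have g: "g x = (\<lambda>w. MAX i. h i x w)" for x using assms(10) by auto
  show value_eq: "\<forall>x\<in>X. (INF y\<in>{y. (x, y) \<in> feas}. obj (x, y)) = primal x"
  proof
    fix x assume "x \<in> X"
    then show "(INF y\<in>{y. (x, y) \<in> feas}. obj (x, y)) = primal x"
      unfolding primal_def feas_def obj_def g
      using assms(1-8) h_proper h_usc h_concave
      by (intro reform_value_eq_primal) (auto simp: less_imp_le)
  qed
  \<comment> \<open>Feasible decisions lie over \<open>X\<close>, so the iterated infimum over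
    \<open>X\<close> and the fibres runs over all of \<open>feas\<close>.\<close>
  have feas_X: "x \<in> X" if "(x, y) \<in> feas" for x y
    using that unfolding feas_def reform_feasible_def by auto
  have "(INF x\<in>X. primal x) = (INF x\<in>X. INF y\<in>{y. (x, y) \<in> feas}. obj (x, y))"
    using value_eq by (intro INF_cong) auto
  also have "\<dots> = (INF d\<in>feas. obj d)"
  proof (rule antisym)
    show "(INF x\<in>X. INF y\<in>{y. (x, y) \<in> feas}. obj (x, y)) \<le> (INF d\<in>feas. obj d)"
    proof (rule INF_greatest)
      fix d assume d: "d \<in> feas"
      obtain x y where xy: "d = (x, y)" by (cases d)
      show "(INF x\<in>X. INF y\<in>{y. (x, y) \<in> feas}. obj (x, y)) \<le> obj d"
        using d feas_X unfolding xy by (intro INF_lower2[of x] INF_lower2[of y]) auto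
    qed
  qed (auto intro!: INF_greatest INF_lower)
  finally show "(INF x\<in>X. primal x) = (INF d\<in>feas. obj d)" .
  show "finite_convex_program (X \<times> UNIV) obj cons"
    unfolding obj_def cons_def using assms(1,2,9) h_convex by (intro finite_convex_program_reform) auto
  show "feas = program_feasible (X \<times> UNIV) cons"
    unfolding feas_def cons_def by (rule reform_feasible_eq_program_feasible)
qed

end
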